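(* Let $A,H$ be vector spaces with bilinear multiplications $A\otimes A\to A$, $H\otimes H\to H$, linear comultiplications $\Delta_A:A\to A\otimes A$, $\Delta_H:H\to H\otimes H$, and linear maps $\rightharpoonup:H\otimes A\to A$, $\leftharpoonup:A\otimes H\to A$, $\triangleright:A\otimes H\to H$, $\triangleleft:H\otimes A\to H$, $\phi:A\to H\otimes A$, $\psi:A\to A\otimes H$, $\rho:H\to A\otimes H$, $\gamma:H\to H\otimes A$, $\sigma:H\otimes H\to A$, $\theta:A\otimes A\to H$, $P:A\to H\otimes H$, $Q:H\to A\otimes A$. Suppose that $A$ and $H$ are cocycle braided anti-flexible bialgebras, and that $(A,H)$ is a cocycle cross product system and a cycle cross coproduct system. Then $A\oplus H$ with multiplication $$(a,x)(b,y)=\big(ab+x\rightharpoonup b+a\leftharpoonup y+\sigma(x,y),\ xy+x\triangleleft b+a\triangleright y+\theta(a,b)\big)$$ and comultiplication $$\Delta_E(a)=(\Delta_A+\phi+\psi+P)(a),\qquad \Delta_E(x)=(\Delta_H+\rho+\gamma+Q)(x)\qquad(a\in A,\ x\in H)$$ is an anti-flexible bialgebra if and only if $(A,H)$ is a cocycle double matched pair.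
   Context: Vector spaces are over a fixed field of characteristic zero; $\tau(u\otimes v)=v\otimes u$, $\tau_{13}(u\otimes v\otimes w)=w\otimes v\otimes u$. Sigma notation: $\Delta_A(a)=a_1\otimes a_2$, $\Delta_H(x)=x_1\otimes x_2$, $\phi(a)=a_{(-1)}\otimes a_{(0)}$, $\psi(a)=a_{(0)}\otimes a_{(1)}$, $\rho(x)=x_{[-1]}\otimes x_{[0]}$, $\gamma(x)=x_{[0]}\otimes x_{[1]}$, $P(a)=a_{<1>}\otimes a_{<2>}$, $Q(x)=x_{\{1\}}\otimes x_{\{2\}}$. All identities are for all $a,b,c\in A$, $x,y,z\in H$. "$T$ is $\tau_{13}$-symmetric" means $T=\tau_{13}(T)$. Anti-flexible algebra: bilinear product with $(ab)c-a(bc)=(cb)a-c(ba)$. Anti-flexible coalgebra: $\Delta$ with $(\Delta\otimes\mathrm{id})\Delta-(\mathrm{id}\otimes\Delta)\Delta$ $\tau_{13}$-symmetric. Anti-flexible bialgebra: both, with $\Delta(ab)+\tau\Delta(ba)=a_1b\otimes a_2+ba_2\otimes a_1+b_1\otimes ab_2+b_2\otimes b_1a$ and $(\mathrm{id}-\tau)(a_1\otimes a_2b+ab_1\otimes b_2-ba_1\otimes a_2-b_1\otimes b_2a)=0$. **Cocycles, cycles.** - $\sigma$ is a cocycle on $H$: $\sigma(xy,z)-\sigma(x,yz)+\sigma(x,y)\leftharpoonup z-x\rightharpoonup\sigma(y,z)=\sigma(zy,x)-\sigma(z,yx)+\sigma(z,y)\leftharpoonup x-z\rightharpoonup\sigma(y,x)$.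 - $\theta$ is a cocycle on $A$: $\theta(ab,c)-\theta(a,bc)+\theta(a,b)\triangleleft c-a\triangleright\theta(b,c)=\theta(cb,a)-\theta(c,ba)+\theta(c,b)\triangleleft a-c\triangleright\theta(b,a)$. - $P$ is a cycle on $A$: $\Delta_H(a_{<1>})\otimes a_{<2>}-a_{<1>}\otimes\Delta_H(a_{<2>})+P(a_{(0)})\otimes a_{(1)}-a_{(-1)}\otimes P(a_{(0)})$ is $\tau_{13}$-symmetric. - $Q$ is a cycle on $H$: $\Delta_A(x_{\{1\}})\otimes x_{\{2\}}-x_{\{1\}}\otimes\Delta_A(x_{\{2\}})+Q(x_{[0]})\otimes x_{[1]}-x_{[-1]}\otimes Q(x_{[0]})$ is $\tau_{13}$-symmetric. - $(H,\sigma)$ is a $\sigma$-anti-flexible algebra: $\sigma$ is a cocycle and $(xy)z-x(yz)+\sigma(x,y)\triangleright z-x\triangleleft\sigma(y,z)=(zy)x-z(yx)+\sigma(z,y)\triangleright x-z\triangleleft\sigma(y,x)$. - $(A,\theta)$ is a $\theta$-anti-flexible algebra: $\theta$ is a cocycle and $(ab)c-a(bc)+\theta(a,b)\rightharpoonup c-a\leftharpoonup\theta(b,c)=(cb)a-c(ba)+\theta(c,b)\rightharpoonup a-c\leftharpoonup\theta(b,a)$. - $(H,P)$ is a $P$-anti-flexible coalgebra: $P$ is a cycle and $\Delta_H(x_1)\otimes x_2-x_1\otimes\Delta_H(x_2)+P(x_{[-1]})\otimes x_{[0]}-x_{[0]}\otimes P(x_{[1]})$ is $\tau_{13}$-symmetric.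 - $(A,Q)$ is a $Q$-anti-flexible coalgebra: $Q$ is a cycle and $\Delta_A(a_1)\otimes a_2-a_1\otimes\Delta_A(a_2)+Q(a_{(-1)})\otimes a_{(0)}-a_{(0)}\otimes Q(a_{(1)})$ is $\tau_{13}$-symmetric. **Cocycle cross product system**: $(A,\theta)$ is a $\theta$-anti-flexible algebra, $(H,\sigma)$ a $\sigma$-anti-flexible algebra, and 1. $x\rightharpoonup(ab)+(ba)\leftharpoonup x+\sigma(x,\theta(a,b))+\sigma(\theta(b,a),x)=(x\rightharpoonup a)b+b(a\leftharpoonup x)+(x\triangleleft a)\rightharpoonup b+b\leftharpoonup(a\triangleright x)$; 2. $(a\leftharpoonup x)b+(a\triangleright x)\rightharpoonup b-a(x\rightharpoonup b)-a\leftharpoonup(x\triangleleft b)=(b\triangleright x)\rightharpoonup a+(b\leftharpoonup x)a-b(x\rightharpoonup a)-b\leftharpoonup(x\triangleleft a)$; 3. $(xy)\rightharpoonup a+\sigma(x,y)a-x\rightharpoonup(y\rightharpoonup a)-\sigma(x,y\triangleleft a)=(a\leftharpoonup y)\leftharpoonup x-a\leftharpoonup(yx)+\sigma(a\triangleright y,x)-a\sigma(y,x)$; 4. $(x\rightharpoonup a)\leftharpoonup y+\sigma(x\triangleleft a,y)-x\rightharpoonup(a\leftharpoonup y)-\sigma(x,a\triangleright y)=(y\rightharpoonup a)\leftharpoonup x+\sigma(y\triangleleft a,x)-y\rightharpoonup(a\leftharpoonup x)-\sigma(y,a\triangleright x)$; 5. $(xy)\triangleleft a+a\triangleright(yx)+\theta(\sigma(x,y),a)+\theta(a,\sigma(y,x))=x(y\triangleleft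 a)+(a\triangleright y)x+x\triangleleft(y\rightharpoonup a)+(a\leftharpoonup y)\triangleright x$; 6. $(x\triangleleft a)y+(x\rightharpoonup a)\triangleright y-x(a\triangleright y)-x\triangleleft(a\leftharpoonup y)=(y\triangleleft a)x+(y\rightharpoonup a)\triangleright x-y(a\triangleright x)-y\triangleleft(a\leftharpoonup x)$; 7. $(ab)\triangleright x+\theta(a,b)x-a\triangleright(b\triangleright x)-\theta(a,b\leftharpoonup x)=(x\triangleleft b)\triangleleft a+\theta(x\rightharpoonup b,a)-x\theta(b,a)-x\triangleleft(ba)$; 8. $(a\triangleright x)\triangleleft b+\theta(a\leftharpoonup x,b)-a\triangleright(x\triangleleft b)-\theta(a,x\rightharpoonup b)=(b\triangleright x)\triangleleft a+\theta(b\leftharpoonup x,a)-b\triangleright(x\triangleleft a)-\theta(b,x\rightharpoonup a)$. **Cycle cross coproduct system**: $(A,Q)$ is a $Q$-anti-flexible coalgebra, $(H,P)$ a $P$-anti-flexible coalgebra, and 1. $\phi(a_1)\otimes a_2+\gamma(a_{(-1)})\otimes a_{(0)}-a_{(-1)}\otimes\Delta_A(a_{(0)})-a_{<1>}\otimes Q(a_{<2>})=\tau_{13}\big(\Delta_A(a_{(0)})\otimes a_{(1)}+Q(a_{<1>})\otimes a_{<2>}-a_1\otimes\psi(a_2)-a_{(0)}\otimes\rho(a_{(1)})\big)$; 2. $\psi(a_1)\otimes a_2+\rho(a_{(-1)})\otimes a_{(0)}-a_1\otimes\phi(a_2)-a_{(0)}\otimes\gamma(a_{(1)})$ is $\tau_{13}$-symmetric;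 3. $\Delta_H(a_{(-1)})\otimes a_{(0)}+P(a_1)\otimes a_2-a_{(-1)}\otimes\phi(a_{(0)})-a_{<1>}\otimes\gamma(a_{<2>})=\tau_{13}\big(\psi(a_{(0)})\otimes a_{(1)}+\rho(a_{<1>})\otimes a_{<2>}-a_{(0)}\otimes\Delta_H(a_{(1)})-a_1\otimes P(a_2)\big)$; 4. $a_{(-1)}\otimes\psi(a_{(0)})+a_{<1>}\otimes\rho(a_{<2>})-\phi(a_{(0)})\otimes a_{(1)}-\gamma(a_{<1>})\otimes a_{<2>}$ is $\tau_{13}$-symmetric; 5. $\rho(x_1)\otimes x_2+\psi(x_{[-1]})\otimes x_{[0]}-x_{[-1]}\otimes\Delta_H(x_{[0]})-x_{\{1\}}\otimes P(x_{\{2\}})=\tau_{13}\big(\Delta_H(x_{[0]})\otimes x_{[1]}+P(x_{\{1\}})\otimes x_{\{2\}}-x_{[0]}\otimes\phi(x_{[1]})-x_1\otimes\gamma(x_2)\big)$; 6. $\gamma(x_1)\otimes x_2+\phi(x_{[-1]})\otimes x_{[0]}-x_{[0]}\otimes\psi(x_{[1]})-x_1\otimes\rho(x_2)$ is $\tau_{13}$-symmetric; 7. $\Delta_A(x_{[-1]})\otimes x_{[0]}+Q(x_1)\otimes x_2-x_{[-1]}\otimes\rho(x_{[0]})-x_{\{1\}}\otimes\psi(x_{\{2\}})=\tau_{13}\big(\gamma(x_{[0]})\otimes x_{[1]}+\phi(x_{\{1\}})\otimes x_{\{2\}}-x_{[0]}\otimes\Delta_A(x_{[1]})-x_1\otimes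 Q(x_2)\big)$; 8. $\rho(x_{[0]})\otimes x_{[1]}+\psi(x_{\{1\}})\otimes x_{\{2\}}-x_{[-1]}\otimes\gamma(x_{[0]})-x_{\{1\}}\otimes\phi(x_{\{2\}})$ is $\tau_{13}$-symmetric. **Cocycle braided anti-flexible bialgebra.** $A$ is one if $(A,\theta)$ is a $\theta$-anti-flexible algebra, $(A,Q)$ a $Q$-anti-flexible coalgebra, and - $\Delta_A(ab)+\tau\Delta_A(ba)+Q\theta(a,b)+\tau Q\theta(b,a)=ba_2\otimes a_1+b_2\otimes b_1a+a_1b\otimes a_2+b_1\otimes ab_2+(b\leftharpoonup a_{(1)})\otimes a_{(0)}+b_{(0)}\otimes(b_{(-1)}\rightharpoonup a)+(a_{(-1)}\rightharpoonup b)\otimes a_{(0)}+b_{(0)}\otimes(a\leftharpoonup b_{(1)})$; - $(\mathrm{id}-\tau)(a_1\otimes a_2b+ab_1\otimes b_2-b_1\otimes b_2a-ba_1\otimes a_2)+(\mathrm{id}-\tau)(a_{(0)}\otimes(a_{(1)}\rightharpoonup b)+(a\leftharpoonup b_{(-1)})\otimes b_{(0)}-b_{(0)}\otimes(b_{(1)}\rightharpoonup a)-(b\leftharpoonup a_{(-1)})\otimes a_{(0)})=0$. $H$ is one if $(H,\sigma)$ is a $\sigma$-anti-flexible algebra, $(H,P)$ a $P$-anti-flexible coalgebra, and - $\Delta_H(xy)+\tau\Delta_H(yx)+P\sigma(x,y)+\tau P\sigma(y,x)=yx_2\otimes x_1+y_2\otimes y_1x+x_1y\otimes x_2+y_1\otimes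 xy_2+(y\triangleleft x_{[1]})\otimes x_{[0]}+y_{[0]}\otimes(y_{[-1]}\triangleright x)+(x_{[-1]}\triangleright y)\otimes x_{[0]}+y_{[0]}\otimes(x\triangleleft y_{[1]})$; - $(\mathrm{id}-\tau)(x_1\otimes x_2y+xy_1\otimes y_2-y_1\otimes y_2x-yx_1\otimes x_2)+(\mathrm{id}-\tau)(x_{[0]}\otimes(x_{[1]}\triangleright y)+(x\triangleleft y_{[-1]})\otimes y_{[0]}-y_{[0]}\otimes(y_{[1]}\triangleright x)-(y\triangleleft x_{[-1]})\otimes x_{[0]})=0$. **Cocycle double matched pair**: the following hold. 1. $\phi(ab)+\tau\psi(ba)+\gamma(\theta(a,b))+\tau\rho(\theta(b,a))=\theta(b,a_2)\otimes a_1+(b\triangleright a_{(1)})\otimes a_{(0)}+b_{<2>}\otimes(b_{<1>}\rightharpoonup a)+b_{(1)}\otimes b_{(0)}a+\theta(a_1,b)\otimes a_2+(a_{(-1)}\triangleleft b)\otimes a_{(0)}+b_{(-1)}\otimes ab_{(0)}+b_{<1>}\otimes(a\leftharpoonup b_{<2>})$; 2. $\rho(xy)+\tau\gamma(yx)+\psi(\sigma(x,y))+\tau\phi(\sigma(y,x))=\sigma(y,x_2)\otimes x_1+(y\rightharpoonup x_{[1]})\otimes x_{[0]}+y_{[1]}\otimes y_{[0]}x+y_{\{2\}}\otimes(y_{\{1\}}\triangleright x)+\sigma(x_1,y)\otimes x_2+(x_{[-1]}\leftharpoonup y)\otimes x_{[0]}+y_{[-1]}\otimes xy_{[0]}+y_{\{1\}}\otimes(x\triangleleft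 y_{\{2\}})$; 3. $\Delta_A(x\rightharpoonup b)+\tau\Delta_A(b\leftharpoonup x)+Q(x\triangleleft b)+\tau Q(b\triangleright x)=(b\leftharpoonup x_{[0]})\otimes x_{[-1]}+bx_{\{2\}}\otimes x_{\{1\}}+b_2\otimes(b_1\leftharpoonup x)+b_{(0)}\otimes\sigma(b_{(-1)},x)+(x_{[0]}\rightharpoonup b)\otimes x_{[1]}+x_{\{1\}}b\otimes x_{\{2\}}+b_1\otimes(x\rightharpoonup b_2)+b_{(0)}\otimes\sigma(x,b_{(1)})$; 4. $\Delta_H(a\triangleright y)+\tau\Delta_H(y\triangleleft a)+P(a\leftharpoonup y)+\tau P(y\rightharpoonup a)=(y\triangleleft a_{(0)})\otimes a_{(-1)}+ya_{<2>}\otimes a_{<1>}+y_2\otimes(y_1\triangleleft a)+y_{[0]}\otimes\theta(y_{[-1]},a)+(a_{(0)}\triangleright y)\otimes a_{(1)}+a_{<1>}y\otimes a_{<2>}+y_1\otimes(a\triangleright y_2)+y_{[0]}\otimes\theta(a,y_{[1]})$; 5. $\Delta_H(\theta(a,b))+\tau\Delta_H(\theta(b,a))+P(ab)+\tau P(ba)=\theta(b,a_{(0)})\otimes a_{(-1)}+(b\triangleright a_{<2>})\otimes a_{<1>}+b_{(1)}\otimes\theta(b_{(0)},a)+b_{<2>}\otimes(b_{<1>}\triangleleft a)+\theta(a_{(0)},b)\otimes a_{(1)}+(a_{<1>}\triangleleft b)\otimes a_{<2>}+b_{(-1)}\otimes\theta(a,b_{(0)})+b_{<1>}\otimes(a\triangleright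 b_{<2>})$; 6. $\Delta_A(\sigma(x,y))+\tau\Delta_A(\sigma(y,x))+Q(xy)+\tau Q(yx)=(y\rightharpoonup x_{\{2\}})\otimes x_{\{1\}}+\sigma(y,x_{[0]})\otimes x_{[-1]}+y_{[1]}\otimes\sigma(y_{[0]},x)+y_{\{2\}}\otimes(y_{\{1\}}\leftharpoonup x)+\sigma(x_{[0]},y)\otimes x_{[1]}+(x_{\{1\}}\leftharpoonup y)\otimes x_{\{2\}}+y_{[-1]}\otimes\sigma(x,y_{[0]})+y_{\{1\}}\otimes(x\rightharpoonup y_{\{2\}})$; 7. $\phi(x\rightharpoonup b)+\tau\psi(b\leftharpoonup x)+\gamma(x\triangleleft b)+\tau\rho(b\triangleright x)=(b\triangleright x_{[0]})\otimes x_{[-1]}+\theta(b,x_{\{2\}})\otimes x_{\{1\}}+b_{(1)}\otimes(b_{(0)}\leftharpoonup x)+b_{<2>}\otimes\sigma(b_{<1>},x)+(x_{[0]}\triangleleft b)\otimes x_{[1]}+\theta(x_{\{1\}},b)\otimes x_{\{2\}}+b_{(-1)}\otimes(x\rightharpoonup b_{(0)})+b_{<1>}\otimes\sigma(x,b_{<2>})$; 8. $\psi(x\rightharpoonup b)+\tau\phi(b\leftharpoonup x)+\rho(x\triangleleft b)+\tau\gamma(b\triangleright x)=(b\leftharpoonup x_2)\otimes x_1+bx_{[1]}\otimes x_{[0]}+b_2\otimes(b_1\triangleright x)+b_{(0)}\otimes b_{(-1)}x+(x_1\rightharpoonup b)\otimes x_2+x_{[-1]}b\otimes x_{[0]}+b_1\otimes(x\triangleleft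 b_2)+b_{(0)}\otimes xb_{(1)}$; 9. $a_1\otimes\theta(a_2,b)+a_{(0)}\otimes(a_{(1)}\triangleleft b)+ab_{(0)}\otimes b_{(1)}+(a\leftharpoonup b_{<1>})\otimes b_{<2>}-b_1\otimes\theta(b_2,a)-b_{(0)}\otimes(b_{(1)}\triangleleft a)-ba_{(0)}\otimes a_{(1)}-(b\leftharpoonup a_{<1>})\otimes a_{<2>}=\tau\big(a_{(-1)}\otimes a_{(0)}b+a_{<1>}\otimes(a_{<2>}\rightharpoonup b)+\theta(a,b_1)\otimes b_2+(a\triangleright b_{(-1)})\otimes b_{(0)}-b_{(-1)}\otimes b_{(0)}a-b_{<1>}\otimes(b_{<2>}\rightharpoonup a)-\theta(b,a_1)\otimes a_2-(b\triangleright a_{(-1)})\otimes a_{(0)}\big)$; 10. $(\mathrm{id}-\tau)(a_{(-1)}\otimes\theta(a_{(0)},b)+a_{<1>}\otimes(a_{<2>}\triangleleft b)+\theta(a,b_{(0)})\otimes b_{(1)}+(a\triangleright b_{<1>})\otimes b_{<2>})=(\mathrm{id}-\tau)(b_{(-1)}\otimes\theta(b_{(0)},a)+b_{<1>}\otimes(b_{<2>}\triangleleft a)+\theta(b,a_{(0)})\otimes a_{(1)}+(b\triangleright a_{<1>})\otimes a_{<2>})$; 11. $(\mathrm{id}-\tau)(x_1\otimes(x_2\triangleleft b)+x_{[0]}\otimes\theta(x_{[1]},b)+(x\triangleleft b_{(0)})\otimes b_{(1)}+xb_{<1>}\otimes b_{<2>})=(\mathrm{id}-\tau)(b_{(-1)}\otimes(b_{(0)}\triangleright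 x)+b_{<1>}\otimes b_{<2>}x+(b\triangleright x_1)\otimes x_2+\theta(b,x_{[-1]})\otimes x_{[0]})$; 12. $(\mathrm{id}-\tau)(x_{[-1]}\otimes(x_{[0]}\rightharpoonup b)+x_{\{1\}}\otimes x_{\{2\}}b+(x\rightharpoonup b_1)\otimes b_2+\sigma(x,b_{(-1)})\otimes b_{(0)})=(\mathrm{id}-\tau)(b_1\otimes(b_2\leftharpoonup x)+b_{(0)}\otimes\sigma(b_{(1)},x)+(b\leftharpoonup x_{[0]})\otimes x_{[1]}+bx_{\{1\}}\otimes x_{\{2\}})$; 13. $x_1\otimes(x_2\rightharpoonup b)+x_{[0]}\otimes x_{[1]}b+(x\triangleleft b_1)\otimes b_2+xb_{(-1)}\otimes b_{(0)}-b_{(-1)}\otimes(b_{(0)}\leftharpoonup x)-b_{<1>}\otimes\sigma(b_{<2>},x)-(b\triangleright x_{[0]})\otimes x_{[1]}-\theta(b,x_{\{1\}})\otimes x_{\{2\}}=\tau\big(x_{[-1]}\otimes(x_{[0]}\triangleleft b)+x_{\{1\}}\otimes\theta(x_{\{2\}},b)+(x\rightharpoonup b_{(0)})\otimes b_{(1)}+\sigma(x,b_{<1>})\otimes b_{<2>}-b_1\otimes(b_2\triangleright x)-b_{(0)}\otimes b_{(1)}x-(b\leftharpoonup x_1)\otimes x_2-bx_{[-1]}\otimes x_{[0]}\big)$; 14. $x_1\otimes\sigma(x_2,y)+x_{[0]}\otimes(x_{[1]}\leftharpoonup y)+xy_{[0]}\otimes y_{[1]}+(x\triangleleft y_{\{1\}})\otimes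 y_{\{2\}}-y_1\otimes\sigma(y_2,x)-y_{[0]}\otimes(y_{[1]}\leftharpoonup x)-yx_{[0]}\otimes x_{[1]}-(y\triangleleft x_{\{1\}})\otimes x_{\{2\}}=\tau\big(x_{[-1]}\otimes x_{[0]}y+x_{\{1\}}\otimes(x_{\{2\}}\triangleright y)+\sigma(x,y_1)\otimes y_2+(x\rightharpoonup y_{[-1]})\otimes y_{[0]}-y_{[-1]}\otimes y_{[0]}x-y_{\{1\}}\otimes(y_{\{2\}}\triangleright x)-\sigma(y,x_1)\otimes x_2-(y\rightharpoonup x_{[-1]})\otimes x_{[0]}\big)$; 15. $(\mathrm{id}-\tau)(x_{[-1]}\otimes\sigma(x_{[0]},y)+x_{\{1\}}\otimes(x_{\{2\}}\leftharpoonup y)+\sigma(x,y_{[0]})\otimes y_{[1]}+(x\rightharpoonup y_{\{1\}})\otimes y_{\{2\}})=(\mathrm{id}-\tau)(y_{[-1]}\otimes\sigma(y_{[0]},x)+y_{\{1\}}\otimes(y_{\{2\}}\leftharpoonup x)+\sigma(y,x_{[0]})\otimes x_{[1]}+(y\rightharpoonup x_{\{1\}})\otimes x_{\{2\}})$. *)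

theory Defs
  imports Complex_Main "HOL-Library.Poly_Mapping" "HOL-Library.Product_Plus"
begin

section \<open>Tensor products\<close>

text \<open>
  The tensor product of vector spaces over a field is the free vector space on the set of pairs
  (or triples), modulo the subspace spanned by the multilinearity relations. Elements of the free
  vector space are finitely supported functions \<open>'p \<Rightarrow>\<^sub>0 'k\<close>. The vector space structures are
  given by explicit scalar multiplications, on which a quotient type cannot depend. Elements of a
  tensor product are therefore represented by formal linear combinations, and equality in the
  tensor product is the congruence modulo the relations (\<open>tensor_eq\<close>, \<open>tensor_eq3\<close>).
\<close>

definition fscale :: "'k::field \<Rightarrow> ('p \<Rightarrow>\<^sub>0 'k) \<Rightarrow> ('p \<Rightarrow>\<^sub>0 'k)" where
  "fscale c T = Poly_Mapping.map ((*) c) T"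

lemma lookup_fscale: "Poly_Mapping.lookup (fscale c T) p = c * Poly_Mapping.lookup T p"
  by (simp add: fscale_def Poly_Mapping.map.rep_eq when_def)

lemma vector_space_fscale: "vector_space (fscale :: 'k::field \<Rightarrow> ('p \<Rightarrow>\<^sub>0 'k) \<Rightarrow> _)"
  by unfold_locales
    (auto intro!: poly_mapping_eqI simp: lookup_fscale lookup_add algebra_simps)

definition tensor :: "'u \<Rightarrow> 'v \<Rightarrow> ('u \<times> 'v \<Rightarrow>\<^sub>0 'k::field)" (infix "\<otimes>" 72) where
  "u \<otimes> v = Poly_Mapping.single (u, v) 1"

definition tensor3 :: "'u \<Rightarrow> 'v \<Rightarrow> 'w \<Rightarrow> ('u \<times> 'v \<times> 'w \<Rightarrow>\<^sub>0 'k::field)" where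
  "tensor3 u v w = Poly_Mapping.single (u, v, w) 1"

definition tensor_relations ::
  "('k::field \<Rightarrow> 'u::ab_group_add \<Rightarrow> 'u) \<Rightarrow> ('k \<Rightarrow> 'v::ab_group_add \<Rightarrow> 'v) \<Rightarrow> ('u \<times> 'v \<Rightarrow>\<^sub>0 'k) set" where
  "tensor_relations s1 s2 =
     {(u + u') \<otimes> v - u \<otimes> v - u' \<otimes> v | u u' v. True} \<union>
     {u \<otimes> (v + v') - u \<otimes> v - u \<otimes> v' | u v v'. True} \<union>
     {s1 c u \<otimes> v - fscale c (u \<otimes> v) | c u v. True} \<union>
     {u \<otimes> s2 c v - fscale c (u \<otimes> v) | c u v. True}"

definition tensor_eq ::
  "('k::field \<Rightarrow> 'u::ab_group_add \<Rightarrow> 'u) \<Rightarrow> ('k \<Rightarrow> 'v::ab_group_add \<Rightarrow> 'v) \<Rightarrow>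
   ('u \<times> 'v \<Rightarrow>\<^sub>0 'k) \<Rightarrow> ('u \<times> 'v \<Rightarrow>\<^sub>0 'k) \<Rightarrow> bool" where
  "tensor_eq s1 s2 S T \<longleftrightarrow> S - T \<in> module.span fscale (tensor_relations s1 s2)"

definition tensor_relations3 ::
  "('k::field \<Rightarrow> 'u::ab_group_add \<Rightarrow> 'u) \<Rightarrow> ('k \<Rightarrow> 'v::ab_group_add \<Rightarrow> 'v) \<Rightarrow>
   ('k \<Rightarrow> 'w::ab_group_add \<Rightarrow> 'w) \<Rightarrow> ('u \<times> 'v \<times> 'w \<Rightarrow>\<^sub>0 'k) set" where
  "tensor_relations3 s1 s2 s3 =
     {tensor3 (u + u') v w - tensor3 u v w - tensor3 u' v w | u u' v w. True} \<union>
     {tensor3 u (v + v') w - tensor3 u v w - tensor3 u v' w | u v v' w. True} \<union>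
     {tensor3 u v (w + w') - tensor3 u v w - tensor3 u v w' | u v w w'. True} \<union>
     {tensor3 (s1 c u) v w - fscale c (tensor3 u v w) | c u v w. True} \<union>
     {tensor3 u (s2 c v) w - fscale c (tensor3 u v w) | c u v w. True} \<union>
     {tensor3 u v (s3 c w) - fscale c (tensor3 u v w) | c u v w. True}"

definition tensor_eq3 ::
  "('k::field \<Rightarrow> 'u::ab_group_add \<Rightarrow> 'u) \<Rightarrow> ('k \<Rightarrow> 'v::ab_group_add \<Rightarrow> 'v) \<Rightarrow>
   ('k \<Rightarrow> 'w::ab_group_add \<Rightarrow> 'w) \<Rightarrow>
   ('u \<times> 'v \<times> 'w \<Rightarrow>\<^sub>0 'k) \<Rightarrow> ('u \<times> 'v \<times> 'w \<Rightarrow>\<^sub>0 'k) \<Rightarrow> bool" where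
  "tensor_eq3 s1 s2 s3 S T \<longleftrightarrow> S - T \<in> module.span fscale (tensor_relations3 s1 s2 s3)"

text \<open>
  Linear extension of a map from the basis; this is the reading of Sigma notation: the element
  written \<open>a\<^sub>1 b \<otimes> a\<^sub>2\<close> for \<open>\<Delta>(a) = a\<^sub>1 \<otimes> a\<^sub>2\<close> is \<open>\<Delta> a \<bind> (\<lambda>(a1, a2). (a1 b) \<otimes> a2)\<close>.
\<close>

definition bind :: "('p \<Rightarrow>\<^sub>0 'k::field) \<Rightarrow> ('p \<Rightarrow> ('q \<Rightarrow>\<^sub>0 'k)) \<Rightarrow> ('q \<Rightarrow>\<^sub>0 'k)" (infixl "\<bind>" 70) where
  "T \<bind> F = (\<Sum>p\<in>Poly_Mapping.keys T. fscale (Poly_Mapping.lookup T p) (F p))"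

definition tau :: "('u \<times> 'v \<Rightarrow>\<^sub>0 'k::field) \<Rightarrow> ('v \<times> 'u \<Rightarrow>\<^sub>0 'k)" where
  "tau T = T \<bind> (\<lambda>(u, v). v \<otimes> u)"

definition tau13 :: "('u \<times> 'v \<times> 'w \<Rightarrow>\<^sub>0 'k::field) \<Rightarrow> ('w \<times> 'v \<times> 'u \<Rightarrow>\<^sub>0 'k)" where
  "tau13 T = T \<bind> (\<lambda>(u, v, w). tensor3 w v u)"

definition id_minus_tau :: "('u \<times> 'u \<Rightarrow>\<^sub>0 'k::field) \<Rightarrow> ('u \<times> 'u \<Rightarrow>\<^sub>0 'k)" where
  "id_minus_tau T = T - tau T"

text \<open>\<open>ext_left f T = (f \<otimes> id)(T)\<close> and \<open>ext_right f T = (id \<otimes> f)(T)\<close>.\<close>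

definition ext_left ::
  "('u \<Rightarrow> ('s \<times> 't \<Rightarrow>\<^sub>0 'k::field)) \<Rightarrow> ('u \<times> 'v \<Rightarrow>\<^sub>0 'k) \<Rightarrow> ('s \<times> 't \<times> 'v \<Rightarrow>\<^sub>0 'k)" where
  "ext_left f T = T \<bind> (\<lambda>(u, v). f u \<bind> (\<lambda>(s, t). tensor3 s t v))"

definition ext_right ::
  "('v \<Rightarrow> ('s \<times> 't \<Rightarrow>\<^sub>0 'k::field)) \<Rightarrow> ('u \<times> 'v \<Rightarrow>\<^sub>0 'k) \<Rightarrow> ('u \<times> 's \<times> 't \<Rightarrow>\<^sub>0 'k)" where
  "ext_right f T = T \<bind> (\<lambda>(u, v). f v \<bind> (\<lambda>(s, t). tensor3 u s t))"

definition bilinear_map ::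
  "('k::field \<Rightarrow> 'u::ab_group_add \<Rightarrow> 'u) \<Rightarrow> ('k \<Rightarrow> 'v::ab_group_add \<Rightarrow> 'v) \<Rightarrow>
   ('k \<Rightarrow> 'w::ab_group_add \<Rightarrow> 'w) \<Rightarrow> ('u \<Rightarrow> 'v \<Rightarrow> 'w) \<Rightarrow> bool" where
  "bilinear_map s1 s2 s3 f \<longleftrightarrow>
     (\<forall>u. Vector_Spaces.linear s2 s3 (f u)) \<and> (\<forall>v. Vector_Spaces.linear s1 s3 (\<lambda>u. f u v))"

text \<open>
  A linear map into a tensor product, given by a choice of representatives of its values.
  Every linear map into the quotient arises in this way, and the identities below depend only on
  the classes of the representatives.
\<close>

definition tensor_linear ::
  "('k::field \<Rightarrow> 'w::ab_group_add \<Rightarrow> 'w) \<Rightarrow> ('k \<Rightarrow> 'u::ab_group_add \<Rightarrow> 'u) \<Rightarrow>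
   ('k \<Rightarrow> 'v::ab_group_add \<Rightarrow> 'v) \<Rightarrow> ('w \<Rightarrow> ('u \<times> 'v \<Rightarrow>\<^sub>0 'k)) \<Rightarrow> bool" where
  "tensor_linear s s1 s2 f \<longleftrightarrow>
     (\<forall>x y. tensor_eq s1 s2 (f (x + y)) (f x + f y)) \<and>
     (\<forall>c x. tensor_eq s1 s2 (f (s c x)) (fscale c (f x)))"


section \<open>Anti-flexible bialgebras\<close>

definition antiflexible_algebra ::
  "('k::field \<Rightarrow> 'v::ab_group_add \<Rightarrow> 'v) \<Rightarrow> ('v \<Rightarrow> 'v \<Rightarrow> 'v) \<Rightarrow> bool" where
  "antiflexible_algebra s m \<longleftrightarrow> vector_space s \<and> bilinear_map s s s m \<and>
     (\<forall>a b c. m (m a b) c - m a (m b c) = m (m c b) a - m c (m b a))"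

definition antiflexible_coalgebra ::
  "('k::field \<Rightarrow> 'v::ab_group_add \<Rightarrow> 'v) \<Rightarrow> ('v \<Rightarrow> ('v \<times> 'v \<Rightarrow>\<^sub>0 'k)) \<Rightarrow> bool" where
  "antiflexible_coalgebra s \<Delta> \<longleftrightarrow> vector_space s \<and> tensor_linear s s s \<Delta> \<and>
     (\<forall>a. let T = ext_left \<Delta> (\<Delta> a) - ext_right \<Delta> (\<Delta> a) in tensor_eq3 s s s T (tau13 T))"

definition antiflexible_bialgebra ::
  "('k::field \<Rightarrow> 'v::ab_group_add \<Rightarrow> 'v) \<Rightarrow> ('v \<Rightarrow> 'v \<Rightarrow> 'v) \<Rightarrow> ('v \<Rightarrow> ('v \<times> 'v \<Rightarrow>\<^sub>0 'k)) \<Rightarrow> bool" where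
  "antiflexible_bialgebra s m \<Delta> \<longleftrightarrow> antiflexible_algebra s m \<and> antiflexible_coalgebra s \<Delta> \<and>
     (\<forall>a b. tensor_eq s s
        (\<Delta> (m a b) + tau (\<Delta> (m b a)))
        (\<Delta> a \<bind> (\<lambda>(a1, a2). m a1 b \<otimes> a2) + \<Delta> a \<bind> (\<lambda>(a1, a2). m b a2 \<otimes> a1)
         + \<Delta> b \<bind> (\<lambda>(b1, b2). b1 \<otimes> m a b2) + \<Delta> b \<bind> (\<lambda>(b1, b2). b2 \<otimes> m b1 a))) \<and>
     (\<forall>a b. tensor_eq s s
        (id_minus_tau
          (\<Delta> a \<bind> (\<lambda>(a1, a2). a1 \<otimes> m a2 b) + \<Delta> b \<bind> (\<lambda>(b1, b2). m a b1 \<otimes> b2)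
           - \<Delta> a \<bind> (\<lambda>(a1, a2). m b a1 \<otimes> a2) - \<Delta> b \<bind> (\<lambda>(b1, b2). b1 \<otimes> m b2 a)))
        0)"


section \<open>Pairs with mutual actions, coactions, cocycles and cycles\<close>

text \<open>
  The locale only fixes the structure maps and their notation. The multiplications are
  \<open>a \<cdot> b\<close> on \<open>A\<close> and \<open>x \<odot> y\<close> on \<open>H\<close>.
\<close>

locale antiflexible_pair =
  fixes sA :: "'k::field \<Rightarrow> 'a::ab_group_add \<Rightarrow> 'a"
    and sH :: "'k \<Rightarrow> 'h::ab_group_add \<Rightarrow> 'h"
    and mA :: "'a \<Rightarrow> 'a \<Rightarrow> 'a" (infixl "\<cdot>" 75)
    and mH :: "'h \<Rightarrow> 'h \<Rightarrow> 'h" (infixl "\<odot>" 75)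
    and \<Delta>A :: "'a \<Rightarrow> ('a \<times> 'a \<Rightarrow>\<^sub>0 'k)"
    and \<Delta>H :: "'h \<Rightarrow> ('h \<times> 'h \<Rightarrow>\<^sub>0 'k)"
    and lA :: "'h \<Rightarrow> 'a \<Rightarrow> 'a" (infix "\<rightharpoonup>" 75)
    and rA :: "'a \<Rightarrow> 'h \<Rightarrow> 'a" (infix "\<leftharpoonup>" 75)
    and lH :: "'a \<Rightarrow> 'h \<Rightarrow> 'h" (infix "\<triangleright>" 75)
    and rH :: "'h \<Rightarrow> 'a \<Rightarrow> 'h" (infix "\<triangleleft>" 75)
    and \<phi> :: "'a \<Rightarrow> ('h \<times> 'a \<Rightarrow>\<^sub>0 'k)"
    and \<psi> :: "'a \<Rightarrow> ('a \<times> 'h \<Rightarrow>\<^sub>0 'k)"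
    and \<rho> :: "'h \<Rightarrow> ('a \<times> 'h \<Rightarrow>\<^sub>0 'k)"
    and \<gamma> :: "'h \<Rightarrow> ('h \<times> 'a \<Rightarrow>\<^sub>0 'k)"
    and \<sigma> :: "'h \<Rightarrow> 'h \<Rightarrow> 'a"
    and \<theta> :: "'a \<Rightarrow> 'a \<Rightarrow> 'h"
    and P :: "'a \<Rightarrow> ('h \<times> 'h \<Rightarrow>\<^sub>0 'k)"
    and Q :: "'h \<Rightarrow> ('a \<times> 'a \<Rightarrow>\<^sub>0 'k)"
begin

definition cocycle_H :: bool where
  "cocycle_H \<longleftrightarrow> (\<forall>x y z.
     \<sigma> (x \<odot> y) z - \<sigma> x (y \<odot> z) + \<sigma> x y \<leftharpoonup> z - x \<rightharpoonup> \<sigma> y z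
     = \<sigma> (z \<odot> y) x - \<sigma> z (y \<odot> x) + \<sigma> z y \<leftharpoonup> x - z \<rightharpoonup> \<sigma> y x)"

definition cocycle_A :: bool where
  "cocycle_A \<longleftrightarrow> (\<forall>a b c.
     \<theta> (a \<cdot> b) c - \<theta> a (b \<cdot> c) + \<theta> a b \<triangleleft> c - a \<triangleright> \<theta> b c
     = \<theta> (c \<cdot> b) a - \<theta> c (b \<cdot> a) + \<theta> c b \<triangleleft> a - c \<triangleright> \<theta> b a)"

definition cycle_A :: bool where
  "cycle_A \<longleftrightarrow> (\<forall>a.
     let T = ext_left \<Delta>H (P a) - ext_right \<Delta>H (P a) + ext_left P (\<psi> a) - ext_right P (\<phi> a)
     in tensor_eq3 sH sH sH T (tau13 T))"

definition cycle_H :: bool where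
  "cycle_H \<longleftrightarrow> (\<forall>x.
     let T = ext_left \<Delta>A (Q x) - ext_right \<Delta>A (Q x) + ext_left Q (\<gamma> x) - ext_right Q (\<rho> x)
     in tensor_eq3 sA sA sA T (tau13 T))"

definition sigma_antiflexible_algebra :: bool where
  "sigma_antiflexible_algebra \<longleftrightarrow> cocycle_H \<and> (\<forall>x y z.
     (x \<odot> y) \<odot> z - x \<odot> (y \<odot> z) + \<sigma> x y \<triangleright> z - x \<triangleleft> \<sigma> y z
     = (z \<odot> y) \<odot> x - z \<odot> (y \<odot> x) + \<sigma> z y \<triangleright> x - z \<triangleleft> \<sigma> y x)"

definition theta_antiflexible_algebra :: bool where
  "theta_antiflexible_algebra \<longleftrightarrow> cocycle_A \<and> (\<forall>a b c.
     (a \<cdot> b) \<cdot> c - a \<cdot> (b \<cdot> c) + \<theta> a b \<rightharpoonup> c - a \<leftharpoonup> \<theta> b c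
     = (c \<cdot> b) \<cdot> a - c \<cdot> (b \<cdot> a) + \<theta> c b \<rightharpoonup> a - c \<leftharpoonup> \<theta> b a)"

definition P_antiflexible_coalgebra :: bool where
  "P_antiflexible_coalgebra \<longleftrightarrow> cycle_A \<and> (\<forall>x.
     let T = ext_left \<Delta>H (\<Delta>H x) - ext_right \<Delta>H (\<Delta>H x) + ext_left P (\<rho> x) - ext_right P (\<gamma> x)
     in tensor_eq3 sH sH sH T (tau13 T))"

definition Q_antiflexible_coalgebra :: bool where
  "Q_antiflexible_coalgebra \<longleftrightarrow> cycle_H \<and> (\<forall>a.
     let T = ext_left \<Delta>A (\<Delta>A a) - ext_right \<Delta>A (\<Delta>A a) + ext_left Q (\<phi> a) - ext_right Q (\<psi> a)
     in tensor_eq3 sA sA sA T (tau13 T))"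

definition cocycle_cross_product_system :: bool where
  "cocycle_cross_product_system \<longleftrightarrow> theta_antiflexible_algebra \<and> sigma_antiflexible_algebra \<and>
   (\<forall>a b x.
      x \<rightharpoonup> (a \<cdot> b) + (b \<cdot> a) \<leftharpoonup> x + \<sigma> x (\<theta> a b) + \<sigma> (\<theta> b a) x
      = (x \<rightharpoonup> a) \<cdot> b + b \<cdot> (a \<leftharpoonup> x) + (x \<triangleleft> a) \<rightharpoonup> b + b \<leftharpoonup> (a \<triangleright> x)) \<and>
   (\<forall>a b x.
      (a \<leftharpoonup> x) \<cdot> b + (a \<triangleright> x) \<rightharpoonup> b - a \<cdot> (x \<rightharpoonup> b) - a \<leftharpoonup> (x \<triangleleft> b)
      = (b \<triangleright> x) \<rightharpoonup> a + (b \<leftharpoonup> x) \<cdot> a - b \<cdot> (x \<rightharpoonup> a) - b \<leftharpoonup> (x \<triangleleft> a)) \<and>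
   (\<forall>a x y.
      (x \<odot> y) \<rightharpoonup> a + \<sigma> x y \<cdot> a - x \<rightharpoonup> (y \<rightharpoonup> a) - \<sigma> x (y \<triangleleft> a)
      = (a \<leftharpoonup> y) \<leftharpoonup> x - a \<leftharpoonup> (y \<odot> x) + \<sigma> (a \<triangleright> y) x - a \<cdot> \<sigma> y x) \<and>
   (\<forall>a x y.
      (x \<rightharpoonup> a) \<leftharpoonup> y + \<sigma> (x \<triangleleft> a) y - x \<rightharpoonup> (a \<leftharpoonup> y) - \<sigma> x (a \<triangleright> y)
      = (y \<rightharpoonup> a) \<leftharpoonup> x + \<sigma> (y \<triangleleft> a) x - y \<rightharpoonup> (a \<leftharpoonup> x) - \<sigma> y (a \<triangleright> x)) \<and>
   (\<forall>a x y.
      (x \<odot> y) \<triangleleft> a + a \<triangleright> (y \<odot> x) + \<theta> (\<sigma> x y) a + \<theta> a (\<sigma> y x)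
      = x \<odot> (y \<triangleleft> a) + (a \<triangleright> y) \<odot> x + x \<triangleleft> (y \<rightharpoonup> a) + (a \<leftharpoonup> y) \<triangleright> x) \<and>
   (\<forall>a x y.
      (x \<triangleleft> a) \<odot> y + (x \<rightharpoonup> a) \<triangleright> y - x \<odot> (a \<triangleright> y) - x \<triangleleft> (a \<leftharpoonup> y)
      = (y \<triangleleft> a) \<odot> x + (y \<rightharpoonup> a) \<triangleright> x - y \<odot> (a \<triangleright> x) - y \<triangleleft> (a \<leftharpoonup> x)) \<and>
   (\<forall>a b x.
      (a \<cdot> b) \<triangleright> x + \<theta> a b \<odot> x - a \<triangleright> (b \<triangleright> x) - \<theta> a (b \<leftharpoonup> x)
      = (x \<triangleleft> b) \<triangleleft> a + \<theta> (x \<rightharpoonup> b) a - x \<odot> \<theta> b a - x \<triangleleft> (b \<cdot> a)) \<and>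
   (\<forall>a b x.
      (a \<triangleright> x) \<triangleleft> b + \<theta> (a \<leftharpoonup> x) b - a \<triangleright> (x \<triangleleft> b) - \<theta> a (x \<rightharpoonup> b)
      = (b \<triangleright> x) \<triangleleft> a + \<theta> (b \<leftharpoonup> x) a - b \<triangleright> (x \<triangleleft> a) - \<theta> b (x \<rightharpoonup> a))"

definition cycle_cross_coproduct_system :: bool where
  "cycle_cross_coproduct_system \<longleftrightarrow> Q_antiflexible_coalgebra \<and> P_antiflexible_coalgebra \<and>
   (\<forall>a. tensor_eq3 sH sA sA
      (ext_left \<phi> (\<Delta>A a) + ext_left \<gamma> (\<phi> a) - ext_right \<Delta>A (\<phi> a) - ext_right Q (P a))
      (tau13 (ext_left \<Delta>A (\<psi> a) + ext_left Q (P a) - ext_right \<psi> (\<Delta>A a) - ext_right \<rho> (\<psi> a)))) \<and>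
   (\<forall>a.
      let T = ext_left \<psi> (\<Delta>A a) + ext_left \<rho> (\<phi> a) - ext_right \<phi> (\<Delta>A a) - ext_right \<gamma> (\<psi> a)
      in tensor_eq3 sA sH sA T (tau13 T)) \<and>
   (\<forall>a. tensor_eq3 sH sH sA
      (ext_left \<Delta>H (\<phi> a) + ext_left P (\<Delta>A a) - ext_right \<phi> (\<phi> a) - ext_right \<gamma> (P a))
      (tau13 (ext_left \<psi> (\<psi> a) + ext_left \<rho> (P a) - ext_right \<Delta>H (\<psi> a) - ext_right P (\<Delta>A a)))) \<and>
   (\<forall>a.
      let T = ext_right \<psi> (\<phi> a) + ext_right \<rho> (P a) - ext_left \<phi> (\<psi> a) - ext_left \<gamma> (P a)
      in tensor_eq3 sH sA sH T (tau13 T)) \<and>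
   (\<forall>x. tensor_eq3 sA sH sH
      (ext_left \<rho> (\<Delta>H x) + ext_left \<psi> (\<rho> x) - ext_right \<Delta>H (\<rho> x) - ext_right P (Q x))
      (tau13 (ext_left \<Delta>H (\<gamma> x) + ext_left P (Q x) - ext_right \<phi> (\<gamma> x) - ext_right \<gamma> (\<Delta>H x)))) \<and>
   (\<forall>x.
      let T = ext_left \<gamma> (\<Delta>H x) + ext_left \<phi> (\<rho> x) - ext_right \<psi> (\<gamma> x) - ext_right \<rho> (\<Delta>H x)
      in tensor_eq3 sH sA sH T (tau13 T)) \<and>
   (\<forall>x. tensor_eq3 sA sA sH
      (ext_left \<Delta>A (\<rho> x) + ext_left Q (\<Delta>H x) - ext_right \<rho> (\<rho> x) - ext_right \<psi> (Q x))
      (tau13 (ext_left \<gamma> (\<gamma> x) + ext_left \<phi> (Q x) - ext_right \<Delta>A (\<gamma> x) - ext_right Q (\<Delta>H x)))) \<and>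
   (\<forall>x.
      let T = ext_left \<rho> (\<gamma> x) + ext_left \<psi> (Q x) - ext_right \<gamma> (\<rho> x) - ext_right \<phi> (Q x)
      in tensor_eq3 sA sH sA T (tau13 T))"

definition cocycle_braided_A :: bool where
  "cocycle_braided_A \<longleftrightarrow> theta_antiflexible_algebra \<and> Q_antiflexible_coalgebra \<and>
   (\<forall>a b. tensor_eq sA sA
      (\<Delta>A (a \<cdot> b) + tau (\<Delta>A (b \<cdot> a)) + Q (\<theta> a b) + tau (Q (\<theta> b a)))
      (\<Delta>A a \<bind> (\<lambda>(a1, a2). (b \<cdot> a2) \<otimes> a1)
       + \<Delta>A b \<bind> (\<lambda>(b1, b2). b2 \<otimes> (b1 \<cdot> a))
       + \<Delta>A a \<bind> (\<lambda>(a1, a2). (a1 \<cdot> b) \<otimes> a2)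
       + \<Delta>A b \<bind> (\<lambda>(b1, b2). b1 \<otimes> (a \<cdot> b2))
       + \<psi> a \<bind> (\<lambda>(a0, a1). (b \<leftharpoonup> a1) \<otimes> a0)
       + \<phi> b \<bind> (\<lambda>(b', b0). b0 \<otimes> (b' \<rightharpoonup> a))
       + \<phi> a \<bind> (\<lambda>(a', a0). (a' \<rightharpoonup> b) \<otimes> a0)
       + \<psi> b \<bind> (\<lambda>(b0, b1). b0 \<otimes> (a \<leftharpoonup> b1)))) \<and>
   (\<forall>a b. tensor_eq sA sA
      (id_minus_tau
        (\<Delta>A a \<bind> (\<lambda>(a1, a2). a1 \<otimes> (a2 \<cdot> b))
         + \<Delta>A b \<bind> (\<lambda>(b1, b2). (a \<cdot> b1) \<otimes> b2)
         - \<Delta>A b \<bind> (\<lambda>(b1, b2). b1 \<otimes> (b2 \<cdot> a))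
         - \<Delta>A a \<bind> (\<lambda>(a1, a2). (b \<cdot> a1) \<otimes> a2))
       + id_minus_tau
        (\<psi> a \<bind> (\<lambda>(a0, a1). a0 \<otimes> (a1 \<rightharpoonup> b))
         + \<phi> b \<bind> (\<lambda>(b', b0). (a \<leftharpoonup> b') \<otimes> b0)
         - \<psi> b \<bind> (\<lambda>(b0, b1). b0 \<otimes> (b1 \<rightharpoonup> a))
         - \<phi> a \<bind> (\<lambda>(a', a0). (b \<leftharpoonup> a') \<otimes> a0)))
      0)"

definition cocycle_braided_H :: bool where
  "cocycle_braided_H \<longleftrightarrow> sigma_antiflexible_algebra \<and> P_antiflexible_coalgebra \<and>
   (\<forall>x y. tensor_eq sH sH
      (\<Delta>H (x \<odot> y) + tau (\<Delta>H (y \<odot> x)) + P (\<sigma> x y) + tau (P (\<sigma> y x)))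
      (\<Delta>H x \<bind> (\<lambda>(x1, x2). (y \<odot> x2) \<otimes> x1)
       + \<Delta>H y \<bind> (\<lambda>(y1, y2). y2 \<otimes> (y1 \<odot> x))
       + \<Delta>H x \<bind> (\<lambda>(x1, x2). (x1 \<odot> y) \<otimes> x2)
       + \<Delta>H y \<bind> (\<lambda>(y1, y2). y1 \<otimes> (x \<odot> y2))
       + \<gamma> x \<bind> (\<lambda>(x0, x1). (y \<triangleleft> x1) \<otimes> x0)
       + \<rho> y \<bind> (\<lambda>(y', y0). y0 \<otimes> (y' \<triangleright> x))
       + \<rho> x \<bind> (\<lambda>(x', x0). (x' \<triangleright> y) \<otimes> x0)
       + \<gamma> y \<bind> (\<lambda>(y0, y1). y0 \<otimes> (x \<triangleleft> y1)))) \<and>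
   (\<forall>x y. tensor_eq sH sH
      (id_minus_tau
        (\<Delta>H x \<bind> (\<lambda>(x1, x2). x1 \<otimes> (x2 \<odot> y))
         + \<Delta>H y \<bind> (\<lambda>(y1, y2). (x \<odot> y1) \<otimes> y2)
         - \<Delta>H y \<bind> (\<lambda>(y1, y2). y1 \<otimes> (y2 \<odot> x))
         - \<Delta>H x \<bind> (\<lambda>(x1, x2). (y \<odot> x1) \<otimes> x2))
       + id_minus_tau
        (\<gamma> x \<bind> (\<lambda>(x0, x1). x0 \<otimes> (x1 \<triangleright> y))
         + \<rho> y \<bind> (\<lambda>(y', y0). (x \<triangleleft> y') \<otimes> y0)
         - \<gamma> y \<bind> (\<lambda>(y0, y1). y0 \<otimes> (y1 \<triangleright> x))
         - \<rho> x \<bind> (\<lambda>(x', x0). (y \<triangleleft> x') \<otimes> x0)))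
      0)"

definition cocycle_double_matched_pair :: bool where
  "cocycle_double_matched_pair \<longleftrightarrow>
   (\<forall>a b. tensor_eq sH sA
      (\<phi> (a \<cdot> b) + tau (\<psi> (b \<cdot> a)) + \<gamma> (\<theta> a b) + tau (\<rho> (\<theta> b a)))
      (\<Delta>A a \<bind> (\<lambda>(a1, a2). \<theta> b a2 \<otimes> a1)
       + \<psi> a \<bind> (\<lambda>(a0, a1). (b \<triangleright> a1) \<otimes> a0)
       + P b \<bind> (\<lambda>(b1, b2). b2 \<otimes> (b1 \<rightharpoonup> a))
       + \<psi> b \<bind> (\<lambda>(b0, b1). b1 \<otimes> (b0 \<cdot> a))
       + \<Delta>A a \<bind> (\<lambda>(a1, a2). \<theta> a1 b \<otimes> a2)
       + \<phi> a \<bind> (\<lambda>(a', a0). (a' \<triangleleft> b) \<otimes> a0)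
       + \<phi> b \<bind> (\<lambda>(b', b0). b' \<otimes> (a \<cdot> b0))
       + P b \<bind> (\<lambda>(b1, b2). b1 \<otimes> (a \<leftharpoonup> b2)))) \<and>
   (\<forall>x y. tensor_eq sA sH
      (\<rho> (x \<odot> y) + tau (\<gamma> (y \<odot> x)) + \<psi> (\<sigma> x y) + tau (\<phi> (\<sigma> y x)))
      (\<Delta>H x \<bind> (\<lambda>(x1, x2). \<sigma> y x2 \<otimes> x1)
       + \<gamma> x \<bind> (\<lambda>(x0, x1). (y \<rightharpoonup> x1) \<otimes> x0)
       + \<gamma> y \<bind> (\<lambda>(y0, y1). y1 \<otimes> (y0 \<odot> x))
       + Q y \<bind> (\<lambda>(y1, y2). y2 \<otimes> (y1 \<triangleright> x))
       + \<Delta>H x \<bind> (\<lambda>(x1, x2). \<sigma> x1 y \<otimes> x2)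
       + \<rho> x \<bind> (\<lambda>(x', x0). (x' \<leftharpoonup> y) \<otimes> x0)
       + \<rho> y \<bind> (\<lambda>(y', y0). y' \<otimes> (x \<odot> y0))
       + Q y \<bind> (\<lambda>(y1, y2). y1 \<otimes> (x \<triangleleft> y2)))) \<and>
   (\<forall>x b. tensor_eq sA sA
      (\<Delta>A (x \<rightharpoonup> b) + tau (\<Delta>A (b \<leftharpoonup> x)) + Q (x \<triangleleft> b) + tau (Q (b \<triangleright> x)))
      (\<rho> x \<bind> (\<lambda>(x', x0). (b \<leftharpoonup> x0) \<otimes> x')
       + Q x \<bind> (\<lambda>(x1, x2). (b \<cdot> x2) \<otimes> x1)
       + \<Delta>A b \<bind> (\<lambda>(b1, b2). b2 \<otimes> (b1 \<leftharpoonup> x))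
       + \<phi> b \<bind> (\<lambda>(b', b0). b0 \<otimes> \<sigma> b' x)
       + \<gamma> x \<bind> (\<lambda>(x0, x1). (x0 \<rightharpoonup> b) \<otimes> x1)
       + Q x \<bind> (\<lambda>(x1, x2). (x1 \<cdot> b) \<otimes> x2)
       + \<Delta>A b \<bind> (\<lambda>(b1, b2). b1 \<otimes> (x \<rightharpoonup> b2))
       + \<psi> b \<bind> (\<lambda>(b0, b1). b0 \<otimes> \<sigma> x b1))) \<and>
   (\<forall>a y. tensor_eq sH sH
      (\<Delta>H (a \<triangleright> y) + tau (\<Delta>H (y \<triangleleft> a)) + P (a \<leftharpoonup> y) + tau (P (y \<rightharpoonup> a)))
      (\<phi> a \<bind> (\<lambda>(a', a0). (y \<triangleleft> a0) \<otimes> a')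
       + P a \<bind> (\<lambda>(a1, a2). (y \<odot> a2) \<otimes> a1)
       + \<Delta>H y \<bind> (\<lambda>(y1, y2). y2 \<otimes> (y1 \<triangleleft> a))
       + \<rho> y \<bind> (\<lambda>(y', y0). y0 \<otimes> \<theta> y' a)
       + \<psi> a \<bind> (\<lambda>(a0, a1). (a0 \<triangleright> y) \<otimes> a1)
       + P a \<bind> (\<lambda>(a1, a2). (a1 \<odot> y) \<otimes> a2)
       + \<Delta>H y \<bind> (\<lambda>(y1, y2). y1 \<otimes> (a \<triangleright> y2))
       + \<gamma> y \<bind> (\<lambda>(y0, y1). y0 \<otimes> \<theta> a y1))) \<and>
   (\<forall>a b. tensor_eq sH sH
      (\<Delta>H (\<theta> a b) + tau (\<Delta>H (\<theta> b a)) + P (a \<cdot> b) + tau (P (b \<cdot> a)))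
      (\<phi> a \<bind> (\<lambda>(a', a0). \<theta> b a0 \<otimes> a')
       + P a \<bind> (\<lambda>(a1, a2). (b \<triangleright> a2) \<otimes> a1)
       + \<psi> b \<bind> (\<lambda>(b0, b1). b1 \<otimes> \<theta> b0 a)
       + P b \<bind> (\<lambda>(b1, b2). b2 \<otimes> (b1 \<triangleleft> a))
       + \<psi> a \<bind> (\<lambda>(a0, a1). \<theta> a0 b \<otimes> a1)
       + P a \<bind> (\<lambda>(a1, a2). (a1 \<triangleleft> b) \<otimes> a2)
       + \<phi> b \<bind> (\<lambda>(b', b0). b' \<otimes> \<theta> a b0)
       + P b \<bind> (\<lambda>(b1, b2). b1 \<otimes> (a \<triangleright> b2)))) \<and>
   (\<forall>x y. tensor_eq sA sA
      (\<Delta>A (\<sigma> x y) + tau (\<Delta>A (\<sigma> y x)) + Q (x \<odot> y) + tau (Q (y \<odot> x)))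
      (Q x \<bind> (\<lambda>(x1, x2). (y \<rightharpoonup> x2) \<otimes> x1)
       + \<rho> x \<bind> (\<lambda>(x', x0). \<sigma> y x0 \<otimes> x')
       + \<gamma> y \<bind> (\<lambda>(y0, y1). y1 \<otimes> \<sigma> y0 x)
       + Q y \<bind> (\<lambda>(y1, y2). y2 \<otimes> (y1 \<leftharpoonup> x))
       + \<gamma> x \<bind> (\<lambda>(x0, x1). \<sigma> x0 y \<otimes> x1)
       + Q x \<bind> (\<lambda>(x1, x2). (x1 \<leftharpoonup> y) \<otimes> x2)
       + \<rho> y \<bind> (\<lambda>(y', y0). y' \<otimes> \<sigma> x y0)
       + Q y \<bind> (\<lambda>(y1, y2). y1 \<otimes> (x \<rightharpoonup> y2)))) \<and>
   (\<forall>x b. tensor_eq sH sA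
      (\<phi> (x \<rightharpoonup> b) + tau (\<psi> (b \<leftharpoonup> x)) + \<gamma> (x \<triangleleft> b) + tau (\<rho> (b \<triangleright> x)))
      (\<rho> x \<bind> (\<lambda>(x', x0). (b \<triangleright> x0) \<otimes> x')
       + Q x \<bind> (\<lambda>(x1, x2). \<theta> b x2 \<otimes> x1)
       + \<psi> b \<bind> (\<lambda>(b0, b1). b1 \<otimes> (b0 \<leftharpoonup> x))
       + P b \<bind> (\<lambda>(b1, b2). b2 \<otimes> \<sigma> b1 x)
       + \<gamma> x \<bind> (\<lambda>(x0, x1). (x0 \<triangleleft> b) \<otimes> x1)
       + Q x \<bind> (\<lambda>(x1, x2). \<theta> x1 b \<otimes> x2)
       + \<phi> b \<bind> (\<lambda>(b', b0). b' \<otimes> (x \<rightharpoonup> b0))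
       + P b \<bind> (\<lambda>(b1, b2). b1 \<otimes> \<sigma> x b2))) \<and>
   (\<forall>x b. tensor_eq sA sH
      (\<psi> (x \<rightharpoonup> b) + tau (\<phi> (b \<leftharpoonup> x)) + \<rho> (x \<triangleleft> b) + tau (\<gamma> (b \<triangleright> x)))
      (\<Delta>H x \<bind> (\<lambda>(x1, x2). (b \<leftharpoonup> x2) \<otimes> x1)
       + \<gamma> x \<bind> (\<lambda>(x0, x1). (b \<cdot> x1) \<otimes> x0)
       + \<Delta>A b \<bind> (\<lambda>(b1, b2). b2 \<otimes> (b1 \<triangleright> x))
       + \<phi> b \<bind> (\<lambda>(b', b0). b0 \<otimes> (b' \<odot> x))
       + \<Delta>H x \<bind> (\<lambda>(x1, x2). (x1 \<rightharpoonup> b) \<otimes> x2)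
       + \<rho> x \<bind> (\<lambda>(x', x0). (x' \<cdot> b) \<otimes> x0)
       + \<Delta>A b \<bind> (\<lambda>(b1, b2). b1 \<otimes> (x \<triangleleft> b2))
       + \<psi> b \<bind> (\<lambda>(b0, b1). b0 \<otimes> (x \<odot> b1)))) \<and>
   (\<forall>a b. tensor_eq sA sH
      (\<Delta>A a \<bind> (\<lambda>(a1, a2). a1 \<otimes> \<theta> a2 b)
       + \<psi> a \<bind> (\<lambda>(a0, a1). a0 \<otimes> (a1 \<triangleleft> b))
       + \<psi> b \<bind> (\<lambda>(b0, b1). (a \<cdot> b0) \<otimes> b1)
       + P b \<bind> (\<lambda>(b1, b2). (a \<leftharpoonup> b1) \<otimes> b2)
       - \<Delta>A b \<bind> (\<lambda>(b1, b2). b1 \<otimes> \<theta> b2 a)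
       - \<psi> b \<bind> (\<lambda>(b0, b1). b0 \<otimes> (b1 \<triangleleft> a))
       - \<psi> a \<bind> (\<lambda>(a0, a1). (b \<cdot> a0) \<otimes> a1)
       - P a \<bind> (\<lambda>(a1, a2). (b \<leftharpoonup> a1) \<otimes> a2))
      (tau
        (\<phi> a \<bind> (\<lambda>(a', a0). a' \<otimes> (a0 \<cdot> b))
         + P a \<bind> (\<lambda>(a1, a2). a1 \<otimes> (a2 \<rightharpoonup> b))
         + \<Delta>A b \<bind> (\<lambda>(b1, b2). \<theta> a b1 \<otimes> b2)
         + \<phi> b \<bind> (\<lambda>(b', b0). (a \<triangleright> b') \<otimes> b0)
         - \<phi> b \<bind> (\<lambda>(b', b0). b' \<otimes> (b0 \<cdot> a))
         - P b \<bind> (\<lambda>(b1, b2). b1 \<otimes> (b2 \<rightharpoonup> a))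
         - \<Delta>A a \<bind> (\<lambda>(a1, a2). \<theta> b a1 \<otimes> a2)
         - \<phi> a \<bind> (\<lambda>(a', a0). (b \<triangleright> a') \<otimes> a0)))) \<and>
   (\<forall>a b. tensor_eq sH sH
      (id_minus_tau
        (\<phi> a \<bind> (\<lambda>(a', a0). a' \<otimes> \<theta> a0 b)
         + P a \<bind> (\<lambda>(a1, a2). a1 \<otimes> (a2 \<triangleleft> b))
         + \<psi> b \<bind> (\<lambda>(b0, b1). \<theta> a b0 \<otimes> b1)
         + P b \<bind> (\<lambda>(b1, b2). (a \<triangleright> b1) \<otimes> b2)))
      (id_minus_tau
        (\<phi> b \<bind> (\<lambda>(b', b0). b' \<otimes> \<theta> b0 a)
         + P b \<bind> (\<lambda>(b1, b2). b1 \<otimes> (b2 \<triangleleft> a))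
         + \<psi> a \<bind> (\<lambda>(a0, a1). \<theta> b a0 \<otimes> a1)
         + P a \<bind> (\<lambda>(a1, a2). (b \<triangleright> a1) \<otimes> a2)))) \<and>
   (\<forall>x b. tensor_eq sH sH
      (id_minus_tau
        (\<Delta>H x \<bind> (\<lambda>(x1, x2). x1 \<otimes> (x2 \<triangleleft> b))
         + \<gamma> x \<bind> (\<lambda>(x0, x1). x0 \<otimes> \<theta> x1 b)
         + \<psi> b \<bind> (\<lambda>(b0, b1). (x \<triangleleft> b0) \<otimes> b1)
         + P b \<bind> (\<lambda>(b1, b2). (x \<odot> b1) \<otimes> b2)))
      (id_minus_tau
        (\<phi> b \<bind> (\<lambda>(b', b0). b' \<otimes> (b0 \<triangleright> x))
         + P b \<bind> (\<lambda>(b1, b2). b1 \<otimes> (b2 \<odot> x))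
         + \<Delta>H x \<bind> (\<lambda>(x1, x2). (b \<triangleright> x1) \<otimes> x2)
         + \<rho> x \<bind> (\<lambda>(x', x0). \<theta> b x' \<otimes> x0)))) \<and>
   (\<forall>x b. tensor_eq sA sA
      (id_minus_tau
        (\<rho> x \<bind> (\<lambda>(x', x0). x' \<otimes> (x0 \<rightharpoonup> b))
         + Q x \<bind> (\<lambda>(x1, x2). x1 \<otimes> (x2 \<cdot> b))
         + \<Delta>A b \<bind> (\<lambda>(b1, b2). (x \<rightharpoonup> b1) \<otimes> b2)
         + \<phi> b \<bind> (\<lambda>(b', b0). \<sigma> x b' \<otimes> b0)))
      (id_minus_tau
        (\<Delta>A b \<bind> (\<lambda>(b1, b2). b1 \<otimes> (b2 \<leftharpoonup> x))
         + \<psi> b \<bind> (\<lambda>(b0, b1). b0 \<otimes> \<sigma> b1 x)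
         + \<gamma> x \<bind> (\<lambda>(x0, x1). (b \<leftharpoonup> x0) \<otimes> x1)
         + Q x \<bind> (\<lambda>(x1, x2). (b \<cdot> x1) \<otimes> x2)))) \<and>
   (\<forall>x b. tensor_eq sH sA
      (\<Delta>H x \<bind> (\<lambda>(x1, x2). x1 \<otimes> (x2 \<rightharpoonup> b))
       + \<gamma> x \<bind> (\<lambda>(x0, x1). x0 \<otimes> (x1 \<cdot> b))
       + \<Delta>A b \<bind> (\<lambda>(b1, b2). (x \<triangleleft> b1) \<otimes> b2)
       + \<phi> b \<bind> (\<lambda>(b', b0). (x \<odot> b') \<otimes> b0)
       - \<phi> b \<bind> (\<lambda>(b', b0). b' \<otimes> (b0 \<leftharpoonup> x))
       - P b \<bind> (\<lambda>(b1, b2). b1 \<otimes> \<sigma> b2 x)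
       - \<gamma> x \<bind> (\<lambda>(x0, x1). (b \<triangleright> x0) \<otimes> x1)
       - Q x \<bind> (\<lambda>(x1, x2). \<theta> b x1 \<otimes> x2))
      (tau
        (\<rho> x \<bind> (\<lambda>(x', x0). x' \<otimes> (x0 \<triangleleft> b))
         + Q x \<bind> (\<lambda>(x1, x2). x1 \<otimes> \<theta> x2 b)
         + \<psi> b \<bind> (\<lambda>(b0, b1). (x \<rightharpoonup> b0) \<otimes> b1)
         + P b \<bind> (\<lambda>(b1, b2). \<sigma> x b1 \<otimes> b2)
         - \<Delta>A b \<bind> (\<lambda>(b1, b2). b1 \<otimes> (b2 \<triangleright> x))
         - \<psi> b \<bind> (\<lambda>(b0, b1). b0 \<otimes> (b1 \<odot> x))
         - \<Delta>H x \<bind> (\<lambda>(x1, x2). (b \<leftharpoonup> x1) \<otimes> x2)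
         - \<rho> x \<bind> (\<lambda>(x', x0). (b \<cdot> x') \<otimes> x0)))) \<and>
   (\<forall>x y. tensor_eq sH sA
      (\<Delta>H x \<bind> (\<lambda>(x1, x2). x1 \<otimes> \<sigma> x2 y)
       + \<gamma> x \<bind> (\<lambda>(x0, x1). x0 \<otimes> (x1 \<leftharpoonup> y))
       + \<gamma> y \<bind> (\<lambda>(y0, y1). (x \<odot> y0) \<otimes> y1)
       + Q y \<bind> (\<lambda>(y1, y2). (x \<triangleleft> y1) \<otimes> y2)
       - \<Delta>H y \<bind> (\<lambda>(y1, y2). y1 \<otimes> \<sigma> y2 x)
       - \<gamma> y \<bind> (\<lambda>(y0, y1). y0 \<otimes> (y1 \<leftharpoonup> x))
       - \<gamma> x \<bind> (\<lambda>(x0, x1). (y \<odot> x0) \<otimes> x1)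
       - Q x \<bind> (\<lambda>(x1, x2). (y \<triangleleft> x1) \<otimes> x2))
      (tau
        (\<rho> x \<bind> (\<lambda>(x', x0). x' \<otimes> (x0 \<odot> y))
         + Q x \<bind> (\<lambda>(x1, x2). x1 \<otimes> (x2 \<triangleright> y))
         + \<Delta>H y \<bind> (\<lambda>(y1, y2). \<sigma> x y1 \<otimes> y2)
         + \<rho> y \<bind> (\<lambda>(y', y0). (x \<rightharpoonup> y') \<otimes> y0)
         - \<rho> y \<bind> (\<lambda>(y', y0). y' \<otimes> (y0 \<odot> x))
         - Q y \<bind> (\<lambda>(y1, y2). y1 \<otimes> (y2 \<triangleright> x))
         - \<Delta>H x \<bind> (\<lambda>(x1, x2). \<sigma> y x1 \<otimes> x2)
         - \<rho> x \<bind> (\<lambda>(x', x0). (y \<rightharpoonup> x') \<otimes> x0)))) \<and>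
   (\<forall>x y. tensor_eq sA sA
      (id_minus_tau
        (\<rho> x \<bind> (\<lambda>(x', x0). x' \<otimes> \<sigma> x0 y)
         + Q x \<bind> (\<lambda>(x1, x2). x1 \<otimes> (x2 \<leftharpoonup> y))
         + \<gamma> y \<bind> (\<lambda>(y0, y1). \<sigma> x y0 \<otimes> y1)
         + Q y \<bind> (\<lambda>(y1, y2). (x \<rightharpoonup> y1) \<otimes> y2)))
      (id_minus_tau
        (\<rho> y \<bind> (\<lambda>(y', y0). y' \<otimes> \<sigma> y0 x)
         + Q y \<bind> (\<lambda>(y1, y2). y1 \<otimes> (y2 \<leftharpoonup> x))
         + \<gamma> x \<bind> (\<lambda>(x0, x1). \<sigma> y x0 \<otimes> x1)
         + Q x \<bind> (\<lambda>(x1, x2). (y \<rightharpoonup> x1) \<otimes> x2))))"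

definition scaleE :: "'k \<Rightarrow> 'a \<times> 'h \<Rightarrow> 'a \<times> 'h" where
  "scaleE c = (\<lambda>(a, x). (sA c a, sH c x))"

definition mE :: "'a \<times> 'h \<Rightarrow> 'a \<times> 'h \<Rightarrow> 'a \<times> 'h" where
  "mE = (\<lambda>(a, x) (b, y).
     (a \<cdot> b + x \<rightharpoonup> b + a \<leftharpoonup> y + \<sigma> x y, x \<odot> y + x \<triangleleft> b + a \<triangleright> y + \<theta> a b))"

definition inA :: "'a \<Rightarrow> 'a \<times> 'h" where "inA a = (a, 0)"

definition inH :: "'h \<Rightarrow> 'a \<times> 'h" where "inH x = (0, x)"

text \<open>The sums in \<open>\<Delta>\<^sub>E\<close> are taken in \<open>E \<otimes> E\<close> along the inclusions of \<open>A\<close> and \<open>H\<close> into \<open>E\<close>.\<close>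

definition \<Delta>E :: "'a \<times> 'h \<Rightarrow> (('a \<times> 'h) \<times> ('a \<times> 'h) \<Rightarrow>\<^sub>0 'k)" where
  "\<Delta>E = (\<lambda>(a, x).
     (\<Delta>A a \<bind> (\<lambda>(u, v). inA u \<otimes> inA v) + \<phi> a \<bind> (\<lambda>(u, v). inH u \<otimes> inA v)
      + \<psi> a \<bind> (\<lambda>(u, v). inA u \<otimes> inH v) + P a \<bind> (\<lambda>(u, v). inH u \<otimes> inH v))
   + (\<Delta>H x \<bind> (\<lambda>(u, v). inH u \<otimes> inH v) + \<rho> x \<bind> (\<lambda>(u, v). inA u \<otimes> inH v)
      + \<gamma> x \<bind> (\<lambda>(u, v). inH u \<otimes> inA v) + Q x \<bind> (\<lambda>(u, v). inA u \<otimes> inA v)))"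

end

end

theory Submission
  imports Defs
begin

text \<open>
  Linear functionals separate the points of a quotient space, so two formal combinations are equal
  in a tensor product iff every scalar-valued multilinear form takes the same value on both. Each
  tensor identity thus becomes a family of identities in the ground field, one for each form.
  The forms on \<open>A \<oplus> H\<close> are the sums of forms on the pairs (or triples) of summands, and the
  failure of each of the two compatibility conditions is multilinear in its arguments and in the
  form. Hence the conditions can be tested on arguments in \<open>A\<close> or \<open>H\<close> and on forms
  that live on a single component. Up to exchanging the arguments or the tensor factors this leaves 19 conditions: the
  four in the definition of a cocycle braided bialgebra (arguments and form all on \<open>A\<close>, or all
  on \<open>H\<close>) and the fifteen of a double matched pair. The algebra and coalgebra axioms of
  \<open>A \<oplus> H\<close> decompose in the same way into those of the cross product and coproduct systems.
\<close>

section \<open>Testing tensors against multilinear forms\<close>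

text \<open>The linear functional on the free vector space with prescribed values \<open>f\<close>
  on the basis. It descends to a tensor product once \<open>f\<close> is multilinear.\<close>

definition pairing :: "('p \<Rightarrow>\<^sub>0 'k::field) \<Rightarrow> ('p \<Rightarrow> 'k) \<Rightarrow> 'k" where
  "pairing T f = (\<Sum>p\<in>Poly_Mapping.keys T. Poly_Mapping.lookup T p * f p)"

definition pair2 :: "('u \<times> 'v \<Rightarrow>\<^sub>0 'k::field) \<Rightarrow> ('u \<Rightarrow> 'v \<Rightarrow> 'k) \<Rightarrow> 'k" where
  "pair2 T \<beta> = pairing T (\<lambda>(u, v). \<beta> u v)"

definition pair3 :: "('u \<times> 'v \<times> 'w \<Rightarrow>\<^sub>0 'k::field) \<Rightarrow> ('u \<Rightarrow> 'v \<Rightarrow> 'w \<Rightarrow> 'k) \<Rightarrow> 'k" where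
  "pair3 T \<beta> = pairing T (\<lambda>(u, v, w). \<beta> u v w)"

text \<open>Terms outside the support have coefficient zero. Cancellation can make the support of a
  sum smaller than the union of the supports, so additivity is checked over that union.\<close>

lemma pairing_superset:
  assumes "finite I" "Poly_Mapping.keys T \<subseteq> I"
  shows "pairing T f = (\<Sum>p\<in>I. Poly_Mapping.lookup T p * f p)"
  unfolding pairing_def using assms
  by (intro sum.mono_neutral_left) (auto simp: in_keys_iff)

lemma pairing_add: "pairing (S + T) f = pairing S f + pairing T f"
proof -
  let ?I = "Poly_Mapping.keys S \<union> Poly_Mapping.keys T"
  have "pairing (S + T) f = (\<Sum>p\<in>?I. Poly_Mapping.lookup (S + T) p * f p)"
    by (rule pairing_superset) (use keys_add[of S T] in auto)
  also have "\<dots> = pairing S f + pairing T f"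
    by (simp add: pairing_superset[of ?I] lookup_add sum.distrib ring_distribs)
  finally show ?thesis .
qed

lemma pairing_fscale: "pairing (fscale c T) f = c * pairing T f"
proof -
  have "pairing (fscale c T) f =
      (\<Sum>p\<in>Poly_Mapping.keys T. Poly_Mapping.lookup (fscale c T) p * f p)"
    by (rule pairing_superset) (auto simp: in_keys_iff lookup_fscale)
  then show ?thesis
    by (simp add: pairing_def lookup_fscale sum_distrib_left mult.assoc)
qed

lemma pairing_zero [simp]: "pairing 0 f = 0"
  by (simp add: pairing_def)

lemma pairing_uminus: "pairing (- T) f = - pairing T f"
  using pairing_add[of T "- T" f] by (simp add: eq_neg_iff_add_eq_0 add.commute)

lemma pairing_diff: "pairing (S - T) f = pairing S f - pairing T f"
  using pairing_add[of S "- T" f] by (simp add: pairing_uminus)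

lemma pairing_sum: "pairing (\<Sum>i\<in>I. T i) f = (\<Sum>i\<in>I. pairing (T i) f)"
  by (induction I rule: infinite_finite_induct) (auto simp: pairing_add)

lemma pairing_single: "pairing (Poly_Mapping.single p c) f = c * f p"
  by (subst pairing_superset[of "{p}"]) auto

text \<open>Evaluating a linear extension amounts to pulling the functional back along
  \<open>F\<close>. In this way an expression in Sigma notation keeps only the original coproduct as
  its tensor, and all operations move into the form.\<close>

lemma pairing_bind: "pairing (T \<bind> F) f = pairing T (\<lambda>p. pairing (F p) f)"
  by (simp add: bind_def pairing_sum pairing_fscale) (simp add: pairing_def)

lemma pairing_add_right: "pairing T (\<lambda>p. f p + g p) = pairing T f + pairing T g"
  by (simp add: pairing_def ring_distribs sum.distrib)

lemma pairing_zero_right [simp]: "pairing T (\<lambda>p. 0) = 0"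
  by (simp add: pairing_def)

lemma pair2_tensor [simp]: "pair2 (u \<otimes> v) \<beta> = \<beta> u v"
  by (simp add: pair2_def tensor_def pairing_single)

lemma pair2_zero [simp]: "pair2 0 \<beta> = 0"
  and pair2_add [simp]: "pair2 (S + T) \<beta> = pair2 S \<beta> + pair2 T \<beta>"
  and pair2_diff [simp]: "pair2 (S - T) \<beta> = pair2 S \<beta> - pair2 T \<beta>"
  and pair2_fscale [simp]: "pair2 (fscale c T) \<beta> = c * pair2 T \<beta>"
  by (simp_all add: pair2_def pairing_add pairing_diff pairing_fscale)

lemma pair2_bind [simp]: "pair2 (T \<bind> (\<lambda>(u, v). F u v)) \<beta> = pair2 T (\<lambda>u v. pair2 (F u v) \<beta>)"
  by (simp add: pair2_def pairing_bind case_prod_unfold)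

lemma pair2_tau [simp]: "pair2 (tau T) \<beta> = pair2 T (\<lambda>u v. \<beta> v u)"
  by (simp add: tau_def)

lemma pair2_zero_right [simp]: "pair2 T (\<lambda>u v. 0) = 0"
  by (simp add: pair2_def case_prod_unfold)

lemma pair2_add_right [simp]: "pair2 T (\<lambda>u v. \<beta> u v + \<beta>' u v) = pair2 T \<beta> + pair2 T \<beta>'"
  by (simp add: pair2_def pairing_add_right case_prod_unfold)

lemma pair3_tensor3 [simp]: "pair3 (tensor3 u v w) \<beta> = \<beta> u v w"
  by (simp add: pair3_def tensor3_def pairing_single)

lemma pair3_zero [simp]: "pair3 0 \<beta> = 0"
  and pair3_add [simp]: "pair3 (S + T) \<beta> = pair3 S \<beta> + pair3 T \<beta>"
  and pair3_diff [simp]: "pair3 (S - T) \<beta> = pair3 S \<beta> - pair3 T \<beta>"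
  and pair3_fscale [simp]: "pair3 (fscale c T) \<beta> = c * pair3 T \<beta>"
  by (simp_all add: pair3_def pairing_add pairing_diff pairing_fscale)

lemma pair3_tau13 [simp]: "pair3 (tau13 T) \<beta> = pair3 T (\<lambda>u v w. \<beta> w v u)"
  by (simp add: tau13_def pair3_def pairing_bind case_prod_unfold tensor3_def pairing_single)

lemma pair3_ext_left [simp]:
  "pair3 (ext_left f T) \<beta> = pair2 T (\<lambda>u v. pair2 (f u) (\<lambda>s t. \<beta> s t v))"
  by (simp add: ext_left_def pair3_def pair2_def pairing_bind case_prod_unfold tensor3_def pairing_single)

lemma pair3_ext_right [simp]:
  "pair3 (ext_right f T) \<beta> = pair2 T (\<lambda>u v. pair2 (f v) (\<lambda>s t. \<beta> u s t))"
  by (simp add: ext_right_def pair3_def pair2_def pairing_bind case_prod_unfold tensor3_def pairing_single)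

section \<open>Bilinear and trilinear forms\<close>

definition bilinear_form ::
  "('k::field \<Rightarrow> 'u::ab_group_add \<Rightarrow> 'u) \<Rightarrow> ('k \<Rightarrow> 'v::ab_group_add \<Rightarrow> 'v) \<Rightarrow> ('u \<Rightarrow> 'v \<Rightarrow> 'k) \<Rightarrow> bool" where
  "bilinear_form s1 s2 \<beta> \<longleftrightarrow>
     (\<forall>u u' v. \<beta> (u + u') v = \<beta> u v + \<beta> u' v) \<and> (\<forall>u v v'. \<beta> u (v + v') = \<beta> u v + \<beta> u v') \<and>
     (\<forall>c u v. \<beta> (s1 c u) v = c * \<beta> u v) \<and> (\<forall>c u v. \<beta> u (s2 c v) = c * \<beta> u v)"

text \<open>Freezing the first slot gives linearity in the second and third, freezing the second
  gives linearity in the first. Bilinearity with the third slot frozen is then a consequence, see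
  \<open>trilinear_form_bilinear\<close>.\<close>

definition trilinear_form ::
  "('k::field \<Rightarrow> 'u::ab_group_add \<Rightarrow> 'u) \<Rightarrow> ('k \<Rightarrow> 'v::ab_group_add \<Rightarrow> 'v) \<Rightarrow>
   ('k \<Rightarrow> 'w::ab_group_add \<Rightarrow> 'w) \<Rightarrow> ('u \<Rightarrow> 'v \<Rightarrow> 'w \<Rightarrow> 'k) \<Rightarrow> bool" where
  "trilinear_form s1 s2 s3 \<beta> \<longleftrightarrow>
     (\<forall>u. bilinear_form s2 s3 (\<beta> u)) \<and> (\<forall>v. bilinear_form s1 s3 (\<lambda>u w. \<beta> u v w))"

lemma bilinear_form_swap: "bilinear_form s1 s2 \<beta> \<Longrightarrow> bilinear_form s2 s1 (\<lambda>u v. \<beta> v u)"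
  by (simp add: bilinear_form_def)

lemma bilinear_form_add_left: "bilinear_form s1 s2 \<beta> \<Longrightarrow> \<beta> (u + u') v = \<beta> u v + \<beta> u' v"
  and bilinear_form_add_right: "bilinear_form s1 s2 \<beta> \<Longrightarrow> \<beta> u (v + v') = \<beta> u v + \<beta> u v'"
  and bilinear_form_scale_left: "bilinear_form s1 s2 \<beta> \<Longrightarrow> \<beta> (s1 c u) v = c * \<beta> u v"
  and bilinear_form_scale_right: "bilinear_form s1 s2 \<beta> \<Longrightarrow> \<beta> u (s2 c v) = c * \<beta> u v"
  by (simp_all add: bilinear_form_def)

lemma bilinear_form_zero_left: "bilinear_form s1 s2 \<beta> \<Longrightarrow> \<beta> 0 v = 0"
  using bilinear_form_add_left[of s1 s2 \<beta> 0 0 v] unfolding add_0_left by (metis add_cancel_right_right)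

lemma bilinear_form_zero_right: "bilinear_form s1 s2 \<beta> \<Longrightarrow> \<beta> u 0 = 0"
  using bilinear_form_add_right[of s1 s2 \<beta> u 0 0] unfolding add_0_left by (metis add_cancel_right_right)

lemma trilinear_form_bilinear:
  assumes "trilinear_form s1 s2 s3 \<beta>"
  shows "bilinear_form s2 s3 (\<lambda>v w. \<beta> u v w)" "bilinear_form s1 s2 (\<lambda>u v. \<beta> u v w)"
  using assms by (auto simp: trilinear_form_def bilinear_form_def)

text \<open>Transposition is a bijection between the bilinear forms for the two orders of the
  factors, so a quantifier over all forms absorbs it.\<close>

lemma all_bilinear_forms_swap:
  "(\<forall>\<beta>. bilinear_form s1 s2 \<beta> \<longrightarrow> F (\<lambda>u v. \<beta> v u)) \<longleftrightarrow> (\<forall>\<beta>. bilinear_form s2 s1 \<beta> \<longrightarrow> F \<beta>)"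
proof safe
  fix \<beta> assume "\<forall>\<beta>. bilinear_form s1 s2 \<beta> \<longrightarrow> F (\<lambda>u v. \<beta> v u)" "bilinear_form s2 s1 \<beta>"
  then show "F \<beta>" using bilinear_form_swap[of s2 s1 \<beta>] by (auto dest!: spec[of _ "\<lambda>u v. \<beta> v u"])
qed (simp add: bilinear_form_swap)

lemma trilinear_form_swap:
  "trilinear_form s1 s2 s3 \<beta> \<Longrightarrow> trilinear_form s3 s2 s1 (\<lambda>u v w. \<beta> w v u)"
  by (auto simp: trilinear_form_def bilinear_form_def)

section \<open>Separation by functionals and equality of tensors\<close>

text \<open>A maximal independent subset \<open>B\<close> of \<open>R\<close> spans
  \<open>R\<close>, and it stays independent when \<open>x\<close> is added. A functional can
  therefore be prescribed as 1 at \<open>x\<close> and 0 on \<open>B\<close>, and it then kills all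
  of \<open>R\<close>.\<close>

lemma separating_functional:
  assumes "vector_space s" and x: "x \<notin> module.span s R"
  obtains g where "Vector_Spaces.linear s (*) g" "\<And>r. r \<in> R \<Longrightarrow> g r = 0" "g x = (1::'k::field)"
proof -
  interpret vector_space s by fact
  interpret vector_space_pair s "(*) :: 'k \<Rightarrow> 'k \<Rightarrow> 'k"
    by unfold_locales (simp_all add: algebra_simps)
  obtain B where B: "B \<subseteq> R" "independent B" "R \<subseteq> span B"
    using maximal_independent_subset by blast
  have xB: "x \<notin> span B" using x span_mono[OF B(1)] by blast
  then have ind: "independent (insert x B)" using B(2) by (rule independent_insertI)
  define g where "g = construct (insert x B) (\<lambda>b. if b = x then (1::'k) else 0)"
  have lin: "Vector_Spaces.linear s (*) g" unfolding g_def using ind by (rule linear_construct)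
  have basis: "g b = (if b = x then 1 else 0)" if "b \<in> insert x B" for b
    unfolding g_def using construct_basis[OF ind that] by simp
  have "g b = 0" if "b \<in> B" for b
    using that xB basis[of b] span_base[of b B] by auto
  then have "g r = 0" if "r \<in> R" for r
    using linear_eq_0_on_span[OF lin, of B r] that B(3) by blast
  with lin basis[of x] show thesis using that[of g] by simp
qed

text \<open>A functional on the free vector space is determined by its values on the basis. This
  identifies the functional obtained by separation with an evaluation.\<close>

lemma linear_functional_eq_pairing:
  fixes T :: "'b \<Rightarrow>\<^sub>0 'a::field"
  assumes "Vector_Spaces.linear fscale (*) g"
  shows "g T = pairing T (\<lambda>p. g (Poly_Mapping.single p 1))"
proof -
  interpret vector_space "fscale :: 'a \<Rightarrow> ('b \<Rightarrow>\<^sub>0 'a) \<Rightarrow> _" by (rule vector_space_fscale)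
  interpret Vector_Spaces.linear "fscale :: 'a \<Rightarrow> ('b \<Rightarrow>\<^sub>0 'a) \<Rightarrow> _" "(*)" g by fact
  have "T = (\<Sum>p\<in>Poly_Mapping.keys T. fscale (Poly_Mapping.lookup T p) (Poly_Mapping.single p 1))"
    by (rule poly_mapping_eqI)
      (simp add: lookup_sum lookup_fscale lookup_single when_def in_keys_iff if_distrib[of "(*) _"]
        sum.delta cong: if_cong)
  then have "g T = g (\<Sum>p\<in>Poly_Mapping.keys T. fscale (Poly_Mapping.lookup T p) (Poly_Mapping.single p 1))"
    by simp
  then show ?thesis
    by (simp add: sum scale pairing_def)
qed

lemma pairing_eq_zero_on_span:
  fixes T :: "'b \<Rightarrow>\<^sub>0 'a::field"
  assumes "T \<in> module.span fscale R" "\<And>r. r \<in> R \<Longrightarrow> pairing r f = 0"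
  shows "pairing T f = 0"
proof -
  interpret vector_space "fscale :: 'a \<Rightarrow> ('b \<Rightarrow>\<^sub>0 'a) \<Rightarrow> _" by (rule vector_space_fscale)
  show ?thesis using assms(1)
    by (rule span_induct) (auto simp: subspace_def pairing_add pairing_fscale assms(2))
qed

text \<open>A bilinear form gives a functional that kills the relations, so it cannot distinguish
  equal tensors. Conversely, if \<open>S - T\<close> lies outside the span of the relations, a
  separating functional restricts to a bilinear form that distinguishes \<open>S\<close> from
  \<open>T\<close>.\<close>

lemma tensor_eq_iff:
  "tensor_eq s1 s2 S T \<longleftrightarrow> (\<forall>\<beta>. bilinear_form s1 s2 \<beta> \<longrightarrow> pair2 S \<beta> = pair2 T \<beta>)"
proof
  assume ST: "tensor_eq s1 s2 S T"
  show "\<forall>\<beta>. bilinear_form s1 s2 \<beta> \<longrightarrow> pair2 S \<beta> = pair2 T \<beta>"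
  proof safe
    fix \<beta> assume \<beta>: "bilinear_form s1 s2 \<beta>"
    have "pair2 r \<beta> = 0" if "r \<in> tensor_relations s1 s2" for r
      using that \<beta> by (auto simp: tensor_relations_def bilinear_form_def)
    then have "pairing (S - T) (\<lambda>(u, v). \<beta> u v) = 0"
      using ST pairing_eq_zero_on_span[of "S - T" "tensor_relations s1 s2" "\<lambda>(u, v). \<beta> u v"]
      by (simp add: tensor_eq_def pair2_def)
    then show "pair2 S \<beta> = pair2 T \<beta>" by (simp add: pairing_diff pair2_def)
  qed
next
  assume eq: "\<forall>\<beta>. bilinear_form s1 s2 \<beta> \<longrightarrow> pair2 S \<beta> = pair2 T \<beta>"
  show "tensor_eq s1 s2 S T"
  proof (rule ccontr)
    assume "\<not> tensor_eq s1 s2 S T"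
    then have "S - T \<notin> module.span fscale (tensor_relations s1 s2)" by (simp add: tensor_eq_def)
    from separating_functional[OF vector_space_fscale this]
    obtain g where g: "Vector_Spaces.linear fscale (*) g"
      "\<And>r. r \<in> tensor_relations s1 s2 \<Longrightarrow> g r = 0" "g (S - T) = 1" by blast
    interpret Vector_Spaces.linear "fscale :: 'a \<Rightarrow> ('b \<times> 'c \<Rightarrow>\<^sub>0 'a) \<Rightarrow> _" "(*)" g by fact
    \<comment> \<open>The values of \<open>g\<close> on pure tensors. That \<open>g\<close> kills
      the four families of relations says precisely that \<beta> is additive and homogeneous in each
      slot.\<close>
    define \<beta> where "\<beta> u v = g (u \<otimes> v)" for u v
    have g_eq: "g U = pair2 U \<beta>" for U
      using linear_functional_eq_pairing[OF g(1), of U]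
      by (simp add: pair2_def \<beta>_def tensor_def case_prod_unfold)
    have "g ((u + u') \<otimes> v - u \<otimes> v - u' \<otimes> v) = 0" "g (u \<otimes> (w + w') - u \<otimes> w - u \<otimes> w') = 0"
      "g (s1 c u \<otimes> v - fscale c (u \<otimes> v)) = 0" "g (u \<otimes> s2 c v - fscale c (u \<otimes> v)) = 0" for u u' v w w' c
      by (rule g(2), unfold tensor_relations_def, blast)+
    then have "bilinear_form s1 s2 \<beta>"
      by (simp add: bilinear_form_def diff scale diff_eq_eq add.commute flip: \<beta>_def)
    with eq g(3) show False by (simp add: g_eq)
  qed
qed

text \<open>The argument for two factors carries over; six families of relations now correspond to
  linearity in three slots.\<close>

lemma tensor_eq3_iff:
  "tensor_eq3 s1 s2 s3 S T \<longleftrightarrow> (\<forall>\<beta>. trilinear_form s1 s2 s3 \<beta> \<longrightarrow> pair3 S \<beta> = pair3 T \<beta>)"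
proof
  assume ST: "tensor_eq3 s1 s2 s3 S T"
  show "\<forall>\<beta>. trilinear_form s1 s2 s3 \<beta> \<longrightarrow> pair3 S \<beta> = pair3 T \<beta>"
  proof safe
    fix \<beta> assume \<beta>: "trilinear_form s1 s2 s3 \<beta>"
    have "pair3 r \<beta> = 0" if "r \<in> tensor_relations3 s1 s2 s3" for r
      using that \<beta> by (auto simp: tensor_relations3_def trilinear_form_def bilinear_form_def)
    then have "pairing (S - T) (\<lambda>(u, v, w). \<beta> u v w) = 0"
      using ST pairing_eq_zero_on_span[of "S - T" "tensor_relations3 s1 s2 s3" "\<lambda>(u, v, w). \<beta> u v w"]
      by (simp add: tensor_eq3_def pair3_def)
    then show "pair3 S \<beta> = pair3 T \<beta>" by (simp add: pairing_diff pair3_def)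
  qed
next
  assume eq: "\<forall>\<beta>. trilinear_form s1 s2 s3 \<beta> \<longrightarrow> pair3 S \<beta> = pair3 T \<beta>"
  show "tensor_eq3 s1 s2 s3 S T"
  proof (rule ccontr)
    assume "\<not> tensor_eq3 s1 s2 s3 S T"
    then have "S - T \<notin> module.span fscale (tensor_relations3 s1 s2 s3)" by (simp add: tensor_eq3_def)
    from separating_functional[OF vector_space_fscale this]
    obtain g where g: "Vector_Spaces.linear fscale (*) g"
      "\<And>r. r \<in> tensor_relations3 s1 s2 s3 \<Longrightarrow> g r = 0" "g (S - T) = 1" by blast
    interpret Vector_Spaces.linear "fscale :: 'a \<Rightarrow> ('b \<times> 'c \<times> 'd \<Rightarrow>\<^sub>0 'a) \<Rightarrow> _" "(*)" g by fact
    define \<beta> where "\<beta> u v w = g (tensor3 u v w)" for u v w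
    have g_eq: "g U = pair3 U \<beta>" for U
      using linear_functional_eq_pairing[OF g(1), of U]
      by (simp add: pair3_def \<beta>_def tensor3_def case_prod_unfold)
    have "g (tensor3 (u + u') v w - tensor3 u v w - tensor3 u' v w) = 0"
      "g (tensor3 u (v + v') w - tensor3 u v w - tensor3 u v' w) = 0"
      "g (tensor3 u v (w + w') - tensor3 u v w - tensor3 u v w') = 0"
      "g (tensor3 (s1 c u) v w - fscale c (tensor3 u v w)) = 0"
      "g (tensor3 u (s2 c v) w - fscale c (tensor3 u v w)) = 0"
      "g (tensor3 u v (s3 c w) - fscale c (tensor3 u v w)) = 0" for u u' v v' w w' c
      by (rule g(2), simp only: tensor_relations3_def Un_iff mem_Collect_eq, fast)+
    then have "trilinear_form s1 s2 s3 \<beta>"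
      by (simp add: trilinear_form_def bilinear_form_def diff scale diff_eq_eq add.commute flip: \<beta>_def)
    with eq g(3) show False by (simp add: g_eq)
  qed
qed

section \<open>Linear maps into tensor products and bilinear maps\<close>

lemma tensor_linear_iff:
  "tensor_linear s s1 s2 f \<longleftrightarrow> (\<forall>\<beta>. bilinear_form s1 s2 \<beta> \<longrightarrow>
     (\<forall>x y. pair2 (f (x + y)) \<beta> = pair2 (f x) \<beta> + pair2 (f y) \<beta>) \<and>
     (\<forall>c x. pair2 (f (s c x)) \<beta> = c * pair2 (f x) \<beta>))"
  by (auto simp: tensor_linear_def tensor_eq_iff)

lemma bilinear_map_add_left: "bilinear_map s1 s2 s3 f \<Longrightarrow> f (u + u') v = f u v + f u' v"
  and bilinear_map_add_right: "bilinear_map s1 s2 s3 f \<Longrightarrow> f u (v + v') = f u v + f u v'"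
  and bilinear_map_scale_left: "bilinear_map s1 s2 s3 f \<Longrightarrow> f (s1 c u) v = s3 c (f u v)"
  and bilinear_map_scale_right: "bilinear_map s1 s2 s3 f \<Longrightarrow> f u (s2 c v) = s3 c (f u v)"
  by (auto simp: bilinear_map_def Vector_Spaces.linear_iff)

lemma bilinear_map_zero_left: "bilinear_map s1 s2 s3 f \<Longrightarrow> f 0 v = 0"
  using bilinear_map_add_left[of s1 s2 s3 f 0 0 v] unfolding add_0_left by (metis add_cancel_right_right)

lemma bilinear_map_zero_right: "bilinear_map s1 s2 s3 f \<Longrightarrow> f u 0 = 0"
  using bilinear_map_add_right[of s1 s2 s3 f u 0 0] unfolding add_0_left by (metis add_cancel_right_right)

lemma tensor_linear_pair2_add:
  "tensor_linear s s1 s2 f \<Longrightarrow> bilinear_form s1 s2 \<beta> \<Longrightarrow>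
   pair2 (f (x + y)) \<beta> = pair2 (f x) \<beta> + pair2 (f y) \<beta>"
  and tensor_linear_pair2_scale:
  "tensor_linear s s1 s2 f \<Longrightarrow> bilinear_form s1 s2 \<beta> \<Longrightarrow> pair2 (f (s c x)) \<beta> = c * pair2 (f x) \<beta>"
  by (auto simp: tensor_linear_iff)

lemma tensor_linear_pair2_zero:
  "tensor_linear s s1 s2 f \<Longrightarrow> bilinear_form s1 s2 \<beta> \<Longrightarrow> pair2 (f 0) \<beta> = 0"
  using tensor_linear_pair2_add[of s s1 s2 f \<beta> 0 0] unfolding add_0_left by (metis add_cancel_right_right)

section \<open>The compatibility conditions of an anti-flexible bialgebra as scalar identities\<close>

text \<open>Left side minus right side of the compatibility condition for \<Delta>(ab), paired with
  \<beta>; \<tau> appears as the transposed form.\<close>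

definition product_defect ::
  "('v \<Rightarrow> 'v \<Rightarrow> 'v) \<Rightarrow> ('v \<Rightarrow> ('v \<times> 'v \<Rightarrow>\<^sub>0 'k::field)) \<Rightarrow> 'v \<Rightarrow> 'v \<Rightarrow> ('v \<Rightarrow> 'v \<Rightarrow> 'k) \<Rightarrow> 'k" where
  "product_defect m \<Delta> a b \<beta> =
     pair2 (\<Delta> (m a b)) \<beta> + pair2 (\<Delta> (m b a)) (\<lambda>u v. \<beta> v u)
     - pair2 (\<Delta> a) (\<lambda>u v. \<beta> (m u b) v) - pair2 (\<Delta> a) (\<lambda>u v. \<beta> (m b v) u)
     - pair2 (\<Delta> b) (\<lambda>u v. \<beta> u (m a v)) - pair2 (\<Delta> b) (\<lambda>u v. \<beta> v (m u a))"

text \<open>The condition with \<open>id - \<tau>\<close>, paired with \<beta>: the first four terms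
  come from the identity, the last four are their transposes with opposite sign.\<close>

definition skew_defect ::
  "('v \<Rightarrow> 'v \<Rightarrow> 'v) \<Rightarrow> ('v \<Rightarrow> ('v \<times> 'v \<Rightarrow>\<^sub>0 'k::field)) \<Rightarrow> 'v \<Rightarrow> 'v \<Rightarrow> ('v \<Rightarrow> 'v \<Rightarrow> 'k) \<Rightarrow> 'k" where
  "skew_defect m \<Delta> a b \<beta> =
     pair2 (\<Delta> a) (\<lambda>u v. \<beta> u (m v b)) + pair2 (\<Delta> b) (\<lambda>u v. \<beta> (m a u) v)
     - pair2 (\<Delta> a) (\<lambda>u v. \<beta> (m b u) v) - pair2 (\<Delta> b) (\<lambda>u v. \<beta> u (m v a))
     - pair2 (\<Delta> a) (\<lambda>u v. \<beta> (m v b) u) - pair2 (\<Delta> b) (\<lambda>u v. \<beta> v (m a u))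
     + pair2 (\<Delta> a) (\<lambda>u v. \<beta> v (m b u)) + pair2 (\<Delta> b) (\<lambda>u v. \<beta> (m v a) u)"

lemma antiflexible_bialgebra_iff:
  "antiflexible_bialgebra s m \<Delta> \<longleftrightarrow> antiflexible_algebra s m \<and> antiflexible_coalgebra s \<Delta> \<and>
     (\<forall>a b \<beta>. bilinear_form s s \<beta> \<longrightarrow> product_defect m \<Delta> a b \<beta> = 0) \<and>
     (\<forall>a b \<beta>. bilinear_form s s \<beta> \<longrightarrow> skew_defect m \<Delta> a b \<beta> = 0)"
  unfolding antiflexible_bialgebra_def tensor_eq_iff
  by (simp add: product_defect_def skew_defect_def id_minus_tau_def algebra_simps)

text \<open>The tensor in the skew condition changes sign when \<open>a\<close> and \<open>b\<close>
  are exchanged, and \<open>id - \<tau>\<close> makes it change sign under transposition as well;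
  hence one operation has the effect of the other.\<close>

lemma product_defect_swap: "product_defect m \<Delta> b a \<beta> = product_defect m \<Delta> a b (\<lambda>u v. \<beta> v u)"
  and skew_defect_swap: "skew_defect m \<Delta> b a \<beta> = skew_defect m \<Delta> a b (\<lambda>u v. \<beta> v u)"
  and skew_defect_swap_form: "skew_defect m \<Delta> a b (\<lambda>u v. \<beta> v u) = - skew_defect m \<Delta> a b \<beta>"
  by (simp_all add: product_defect_def skew_defect_def)

lemma product_defect_add_form:
  "product_defect m \<Delta> a b (\<lambda>u v. \<beta> u v + \<beta>' u v) = product_defect m \<Delta> a b \<beta> + product_defect m \<Delta> a b \<beta>'"
  and skew_defect_add_form:
  "skew_defect m \<Delta> a b (\<lambda>u v. \<beta> u v + \<beta>' u v) = skew_defect m \<Delta> a b \<beta> + skew_defect m \<Delta> a b \<beta>'"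
  by (simp_all add: product_defect_def skew_defect_def algebra_simps)

text \<open>These are the eight shapes in which a product occurs inside the form in the two defects.
  Their bilinearity is what allows linearity of a coproduct to be applied to those terms.\<close>

lemma bilinear_form_mult:
  assumes "bilinear_map s s s m" "bilinear_form s s \<beta>"
  shows "bilinear_form s s (\<lambda>u v. \<beta> (m u b) v)" "bilinear_form s s (\<lambda>u v. \<beta> (m b u) v)"
    "bilinear_form s s (\<lambda>u v. \<beta> u (m v b))" "bilinear_form s s (\<lambda>u v. \<beta> u (m b v))"
    "bilinear_form s s (\<lambda>u v. \<beta> (m v b) u)" "bilinear_form s s (\<lambda>u v. \<beta> (m b v) u)"
    "bilinear_form s s (\<lambda>u v. \<beta> v (m u b))" "bilinear_form s s (\<lambda>u v. \<beta> v (m b u))"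
  using assms(2)
  by (auto simp: bilinear_form_def bilinear_map_add_left[OF assms(1)] bilinear_map_add_right[OF assms(1)]
      bilinear_map_scale_left[OF assms(1)] bilinear_map_scale_right[OF assms(1)])

context
  fixes s m \<Delta> and \<beta> :: "'v::ab_group_add \<Rightarrow> 'v \<Rightarrow> 'k::field"
  assumes m: "bilinear_map s s s m" and \<Delta>: "tensor_linear s s s \<Delta>" and \<beta>: "bilinear_form s s \<beta>"
begin

text \<open>In each term the argument enters either through \<Delta> or through one multiplication
  inside the form. Additivity in the other argument follows later from the exchange laws.\<close>

lemma product_defect_add_left:
  "product_defect m \<Delta> (a + a') b \<beta> = product_defect m \<Delta> a b \<beta> + product_defect m \<Delta> a' b \<beta>"
  and skew_defect_add_left:
  "skew_defect m \<Delta> (a + a') b \<beta> = skew_defect m \<Delta> a b \<beta> + skew_defect m \<Delta> a' b \<beta>"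
  by (simp_all add: product_defect_def skew_defect_def
      bilinear_map_add_left[OF m] bilinear_map_add_right[OF m]
      bilinear_form_add_left[OF \<beta>] bilinear_form_add_right[OF \<beta>]
      tensor_linear_pair2_add[OF \<Delta> \<beta>] tensor_linear_pair2_add[OF \<Delta> bilinear_form_swap[OF \<beta>]]
      bilinear_form_mult[OF m \<beta>, THEN tensor_linear_pair2_add[OF \<Delta>]])

end

section \<open>Combining equations in an abelian group\<close>

text \<open>Lets an identity be proved as a sum of known ones: once the hypotheses are added up to
  \<open>L = R\<close>, only a cancellation of terms has to be checked.\<close>

lemma eq_from_diff: "X - Y = L - R \<Longrightarrow> L = R \<Longrightarrow> X = (Y::'x::ab_group_add)"
  by simp

lemma eq_iff_diff_zero: "L - R = d \<Longrightarrow> (L = R) = (d = (0::'x::ab_group_add))"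
  by auto

lemma add_eqs: "L = R \<Longrightarrow> L' = R' \<Longrightarrow> L + L' = R + (R'::'x::ab_group_add)"
  by simp

lemma sum_eqs8:
  fixes l1 :: "'x::ab_group_add"
  assumes "l1 = r1" "l2 = r2" "l3 = r3" "l4 = r4" "l5 = r5" "l6 = r6" "l7 = r7" "l8 = r8"
  shows "l1 + l2 + l3 + l4 + l5 + l6 + l7 + l8 = r1 + r2 + r3 + r4 + r5 + r6 + r7 + r8"
  using assms by simp

section \<open>The space \<open>A \<oplus> H\<close>\<close>

locale linear_antiflexible_pair = antiflexible_pair +
  assumes vector_space_A: "vector_space sA" and vector_space_H: "vector_space sH"
    and bil_mA: "bilinear_map sA sA sA mA" and bil_mH: "bilinear_map sH sH sH mH"
    and lin_\<Delta>A: "tensor_linear sA sA sA \<Delta>A" and lin_\<Delta>H: "tensor_linear sH sH sH \<Delta>H"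
    and bil_lA: "bilinear_map sH sA sA lA" and bil_rA: "bilinear_map sA sH sA rA"
    and bil_lH: "bilinear_map sA sH sH lH" and bil_rH: "bilinear_map sH sA sH rH"
    and lin_\<phi>: "tensor_linear sA sH sA \<phi>" and lin_\<psi>: "tensor_linear sA sA sH \<psi>"
    and lin_\<rho>: "tensor_linear sH sA sH \<rho>" and lin_\<gamma>: "tensor_linear sH sH sA \<gamma>"
    and bil_\<sigma>: "bilinear_map sH sH sA \<sigma>" and bil_\<theta>: "bilinear_map sA sA sH \<theta>"
    and lin_P: "tensor_linear sA sH sH P" and lin_Q: "tensor_linear sH sA sA Q"
begin

section \<open>Vector space structure and multiplication of \<open>A \<oplus> H\<close>\<close>

lemmas bil_maps = bil_mA bil_mH bil_lA bil_rA bil_lH bil_rH bil_\<sigma> bil_\<theta>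

lemmas map_add = bil_maps[THEN bilinear_map_add_left] bil_maps[THEN bilinear_map_add_right]

lemmas map_scale = bil_maps[THEN bilinear_map_scale_left] bil_maps[THEN bilinear_map_scale_right]

lemmas map_zero = bil_maps[THEN bilinear_map_zero_left] bil_maps[THEN bilinear_map_zero_right]

lemma scale_add: "sA c (a + b) = sA c a + sA c b" "sH c (x + y) = sH c x + sH c y"
proof -
  interpret A: vector_space sA by (rule vector_space_A)
  interpret H: vector_space sH by (rule vector_space_H)
  show "sA c (a + b) = sA c a + sA c b" "sH c (x + y) = sH c x + sH c y"
    by (simp_all add: A.scale_right_distrib H.scale_right_distrib)
qed

lemma scale_zero: "sA c 0 = 0" "sH c 0 = 0"
  using scale_add(1)[of c 0 0] scale_add(2)[of c 0 0] by simp_all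

lemma scaleE_pair: "scaleE c (a, x) = (sA c a, sH c x)"
  by (simp add: scaleE_def)

lemma mE_pair: "mE (a, x) (b, y) =
   (a \<cdot> b + x \<rightharpoonup> b + a \<leftharpoonup> y + \<sigma> x y, x \<odot> y + x \<triangleleft> b + a \<triangleright> y + \<theta> a b)"
  by (simp add: mE_def)

lemma vector_space_E: "vector_space scaleE"
proof -
  interpret A: vector_space sA by (rule vector_space_A)
  interpret H: vector_space sH by (rule vector_space_H)
  show ?thesis
    by unfold_locales
      (auto simp: scaleE_def A.scale_right_distrib A.scale_left_distrib
        H.scale_right_distrib H.scale_left_distrib)
qed

lemma bilinear_mE: "bilinear_map scaleE scaleE scaleE mE"
  unfolding bilinear_map_def Vector_Spaces.linear_iff
  by (auto simp: vector_space_E mE_pair scaleE_pair map_add map_scale scale_add algebra_simps)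

text \<open>The identity splits by component of the result and by the choice of \<open>A\<close> or
  \<open>H\<close> for each of the three arguments. This gives eight cases per component, one
  hypothesis for each; cases interchanged by reversing the arguments use the same condition, once in
  each direction.\<close>

lemma antiflexible_algebra_E:
  assumes "cocycle_cross_product_system"
  shows "antiflexible_algebra scaleE mE"
proof -
  note S = assms[unfolded cocycle_cross_product_system_def theta_antiflexible_algebra_def
      sigma_antiflexible_algebra_def cocycle_A_def cocycle_H_def]
  note SA = S[THEN conjunct1] and SH = S[THEN conjunct2, THEN conjunct1]
  note T1 = S[THEN conjunct2, THEN conjunct2]
  note T2 = T1[THEN conjunct2] note T3 = T2[THEN conjunct2] note T4 = T3[THEN conjunct2]
  note T5 = T4[THEN conjunct2] note T6 = T5[THEN conjunct2] note T7 = T6[THEN conjunct2]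
  note assoc_A = SA[THEN conjunct2, rule_format] and cocycle_\<theta> = SA[THEN conjunct1, rule_format]
  note assoc_H = SH[THEN conjunct2, rule_format] and cocycle_\<sigma> = SH[THEN conjunct1, rule_format]
  note S1 = T1[THEN conjunct1, rule_format] and S2 = T2[THEN conjunct1, rule_format]
    and S3 = T3[THEN conjunct1, rule_format] and S4 = T4[THEN conjunct1, rule_format]
    and S5 = T5[THEN conjunct1, rule_format] and S6 = T6[THEN conjunct1, rule_format]
    and S7 = T7[THEN conjunct1, rule_format] and S8 = T7[THEN conjunct2, rule_format]
  have "mE (mE p q) r - mE p (mE q r) = mE (mE r q) p - mE r (mE q p)" for p q r
  proof -
    obtain a x b y c z where pqr: "p = (a, x)" "q = (b, y)" "r = (c, z)" by (metis surj_pair)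
    txt \<open>
      After expansion, the two components of the identity at \<open>(p, q, r)\<close> are the sums of the
      following instances of the hypotheses.
    \<close>
    note eq1 = assoc_A[of a b c] cocycle_\<sigma>[of x y z] S1[of z b a] S1[of x b c, symmetric]
      S2[of a y c] S3[of x y c] S3[of z y a, symmetric] S4[of x b z]
    note eq2 = cocycle_\<theta>[of a b c] assoc_H[of x y z] S5[of x y c] S5[of z y a, symmetric]
      S6[of x b z] S7[of a b z] S7[of c b x, symmetric] S8[of a y c]
    show ?thesis
      unfolding pqr mE_pair minus_prod_def fst_conv snd_conv
    proof (rule arg_cong2[where f=Pair], goal_cases)
      case 1 show ?case
        by (rule eq_from_diff[OF _ sum_eqs8[OF eq1]]) (simp add: map_add algebra_simps)
    next
      case 2 show ?case
        by (rule eq_from_diff[OF _ sum_eqs8[OF eq2]]) (simp add: map_add algebra_simps)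
    qed
  qed
  then show ?thesis
    by (auto simp: antiflexible_algebra_def vector_space_E bilinear_mE)
qed

section \<open>Forms on \<open>A \<oplus> H\<close> and the coalgebra axiom\<close>

definition pairA :: "'b \<Rightarrow> ('b \<times> 'c \<Rightarrow> 'b \<times> 'c \<Rightarrow> 'a) \<Rightarrow> 'a" where
  "pairA a \<beta> = pair2 (\<Delta>A a) (\<lambda>u v. \<beta> (u, 0) (v, 0)) + pair2 (\<phi> a) (\<lambda>u v. \<beta> (0, u) (v, 0))
     + pair2 (\<psi> a) (\<lambda>u v. \<beta> (u, 0) (0, v)) + pair2 (P a) (\<lambda>u v. \<beta> (0, u) (0, v))"

definition pairH :: "'c \<Rightarrow> ('b \<times> 'c \<Rightarrow> 'b \<times> 'c \<Rightarrow> 'a) \<Rightarrow> 'a" where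
  "pairH x \<beta> = pair2 (\<Delta>H x) (\<lambda>u v. \<beta> (0, u) (0, v)) + pair2 (\<rho> x) (\<lambda>u v. \<beta> (u, 0) (0, v))
     + pair2 (\<gamma> x) (\<lambda>u v. \<beta> (0, u) (v, 0)) + pair2 (Q x) (\<lambda>u v. \<beta> (u, 0) (v, 0))"

lemma pair2_\<Delta>E: "pair2 (\<Delta>E (a, x)) \<beta> = pairA a \<beta> + pairH x \<beta>"
  by (simp add: \<Delta>E_def pairA_def pairH_def inA_def inH_def)

lemma bilinear_form_components:
  assumes "bilinear_form scaleE scaleE \<beta>"
  shows "bilinear_form sA sA (\<lambda>u v. \<beta> (u, 0) (v, 0))" "bilinear_form sH sA (\<lambda>u v. \<beta> (0, u) (v, 0))"
    "bilinear_form sA sH (\<lambda>u v. \<beta> (u, 0) (0, v))" "bilinear_form sH sH (\<lambda>u v. \<beta> (0, u) (0, v))"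
  using assms bilinear_form_add_left[OF assms, of "(_, 0)" "(_, 0)"]
    bilinear_form_add_left[OF assms, of "(0, _)" "(0, _)"]
    bilinear_form_add_right[OF assms, of _ "(_, 0)" "(_, 0)"]
    bilinear_form_add_right[OF assms, of _ "(0, _)" "(0, _)"]
    bilinear_form_scale_left[OF assms, of _ "(_, 0)"] bilinear_form_scale_left[OF assms, of _ "(0, _)"]
    bilinear_form_scale_right[OF assms, of _ _ "(_, 0)"] bilinear_form_scale_right[OF assms, of _ _ "(0, _)"]
  by (auto simp: bilinear_form_def scaleE_pair scale_zero)

text \<open>Pullback along the projections, complementary to the restriction in
  \<open>bilinear_form_components\<close>: together they identify forms on
  \<open>A \<oplus> H\<close> with quadruples of forms on the blocks.\<close>

lemma bilinear_form_lifts: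
  "bilinear_form sA sA \<beta>1 \<Longrightarrow> bilinear_form scaleE scaleE (\<lambda>p q. \<beta>1 (fst p) (fst q))"
  "bilinear_form sH sA \<beta>2 \<Longrightarrow> bilinear_form scaleE scaleE (\<lambda>p q. \<beta>2 (snd p) (fst q))"
  "bilinear_form sA sH \<beta>3 \<Longrightarrow> bilinear_form scaleE scaleE (\<lambda>p q. \<beta>3 (fst p) (snd q))"
  "bilinear_form sH sH \<beta>4 \<Longrightarrow> bilinear_form scaleE scaleE (\<lambda>p q. \<beta>4 (snd p) (snd q))"
  by (auto simp: bilinear_form_def scaleE_pair)

context
  fixes \<beta> assumes \<beta>: "bilinear_form scaleE scaleE \<beta>"
begin

lemmas components = bilinear_form_components[OF \<beta>]

text \<open>The chosen representatives of coproducts are linear only modulo the tensor relations;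
  even \<open>\<Delta>A 0\<close> may be a nonzero formal combination. Bilinearity of the form
  removes the ambiguity.\<close>

lemma pairA_add: "pairA (a + b) \<beta> = pairA a \<beta> + pairA b \<beta>"
  and pairA_scale: "pairA (sA c a) \<beta> = c * pairA a \<beta>"
  and pairA_zero: "pairA 0 \<beta> = 0"
  and pairH_add: "pairH (x + y) \<beta> = pairH x \<beta> + pairH y \<beta>"
  and pairH_scale: "pairH (sH c x) \<beta> = c * pairH x \<beta>"
  and pairH_zero: "pairH 0 \<beta> = 0"
  by (simp_all add: pairA_def pairH_def algebra_simps
      lin_\<Delta>A[THEN tensor_linear_pair2_add, OF components(1)] lin_Q[THEN tensor_linear_pair2_add, OF components(1)]
      lin_\<phi>[THEN tensor_linear_pair2_add, OF components(2)] lin_\<gamma>[THEN tensor_linear_pair2_add, OF components(2)]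
      lin_\<psi>[THEN tensor_linear_pair2_add, OF components(3)] lin_\<rho>[THEN tensor_linear_pair2_add, OF components(3)]
      lin_\<Delta>H[THEN tensor_linear_pair2_add, OF components(4)] lin_P[THEN tensor_linear_pair2_add, OF components(4)]
      lin_\<Delta>A[THEN tensor_linear_pair2_scale, OF components(1)] lin_Q[THEN tensor_linear_pair2_scale, OF components(1)]
      lin_\<phi>[THEN tensor_linear_pair2_scale, OF components(2)] lin_\<gamma>[THEN tensor_linear_pair2_scale, OF components(2)]
      lin_\<psi>[THEN tensor_linear_pair2_scale, OF components(3)] lin_\<rho>[THEN tensor_linear_pair2_scale, OF components(3)]
      lin_\<Delta>H[THEN tensor_linear_pair2_scale, OF components(4)] lin_P[THEN tensor_linear_pair2_scale, OF components(4)]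
      lin_\<Delta>A[THEN tensor_linear_pair2_zero, OF components(1)] lin_Q[THEN tensor_linear_pair2_zero, OF components(1)]
      lin_\<phi>[THEN tensor_linear_pair2_zero, OF components(2)] lin_\<gamma>[THEN tensor_linear_pair2_zero, OF components(2)]
      lin_\<psi>[THEN tensor_linear_pair2_zero, OF components(3)] lin_\<rho>[THEN tensor_linear_pair2_zero, OF components(3)]
      lin_\<Delta>H[THEN tensor_linear_pair2_zero, OF components(4)] lin_P[THEN tensor_linear_pair2_zero, OF components(4)])

lemma pair2_\<Delta>E_A: "pair2 (\<Delta>E (a, 0)) \<beta> = pairA a \<beta>"
  and pair2_\<Delta>E_H: "pair2 (\<Delta>E (0, x)) \<beta> = pairH x \<beta>"
  by (simp_all add: pair2_\<Delta>E pairA_zero pairH_zero)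

lemma bilinear_form_decompose:
  "\<beta> = (\<lambda>p q. \<beta> (fst p, 0) (fst q, 0) + \<beta> (0, snd p) (fst q, 0)
     + \<beta> (fst p, 0) (0, snd q) + \<beta> (0, snd p) (0, snd q))"
proof (intro ext)
  fix p q
  have "\<beta> p q = \<beta> ((fst p, 0) + (0, snd p)) ((fst q, 0) + (0, snd q))" by simp
  also have "\<dots> = \<beta> (fst p, 0) (fst q, 0) + \<beta> (0, snd p) (fst q, 0)
     + \<beta> (fst p, 0) (0, snd q) + \<beta> (0, snd p) (0, snd q)"
    by (simp only: bilinear_form_add_left[OF \<beta>] bilinear_form_add_right[OF \<beta>] add_ac)
  finally show "\<beta> p q = \<beta> (fst p, 0) (fst q, 0) + \<beta> (0, snd p) (fst q, 0)
     + \<beta> (fst p, 0) (0, snd q) + \<beta> (0, snd p) (0, snd q)" .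
qed

end

lemma tensor_linear_\<Delta>E: "tensor_linear scaleE scaleE scaleE \<Delta>E"
  unfolding tensor_linear_iff
  by (auto simp: pair2_\<Delta>E scaleE_pair pairA_add pairH_add pairA_scale pairH_scale algebra_simps)

lemma trilinear_form_components:
  assumes \<beta>: "trilinear_form scaleE scaleE scaleE \<beta>"
  shows "trilinear_form sA sA sA (\<lambda>u v w. \<beta> (u, 0) (v, 0) (w, 0))"
    "trilinear_form sH sA sA (\<lambda>u v w. \<beta> (0, u) (v, 0) (w, 0))"
    "trilinear_form sA sH sA (\<lambda>u v w. \<beta> (u, 0) (0, v) (w, 0))"
    "trilinear_form sA sA sH (\<lambda>u v w. \<beta> (u, 0) (v, 0) (0, w))"
    "trilinear_form sA sH sH (\<lambda>u v w. \<beta> (u, 0) (0, v) (0, w))"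
    "trilinear_form sH sA sH (\<lambda>u v w. \<beta> (0, u) (v, 0) (0, w))"
    "trilinear_form sH sH sA (\<lambda>u v w. \<beta> (0, u) (0, v) (w, 0))"
    "trilinear_form sH sH sH (\<lambda>u v w. \<beta> (0, u) (0, v) (0, w))"
proof -
  have 1: "bilinear_form scaleE scaleE (\<beta> p)" and 2: "bilinear_form scaleE scaleE (\<lambda>q r. \<beta> q p r)" for p
    using \<beta> unfolding trilinear_form_def by blast+
  show "trilinear_form sA sA sA (\<lambda>u v w. \<beta> (u, 0) (v, 0) (w, 0))"
    "trilinear_form sH sA sA (\<lambda>u v w. \<beta> (0, u) (v, 0) (w, 0))"
    "trilinear_form sA sH sA (\<lambda>u v w. \<beta> (u, 0) (0, v) (w, 0))"
    "trilinear_form sA sA sH (\<lambda>u v w. \<beta> (u, 0) (v, 0) (0, w))"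
    "trilinear_form sA sH sH (\<lambda>u v w. \<beta> (u, 0) (0, v) (0, w))"
    "trilinear_form sH sA sH (\<lambda>u v w. \<beta> (0, u) (v, 0) (0, w))"
    "trilinear_form sH sH sA (\<lambda>u v w. \<beta> (0, u) (0, v) (w, 0))"
    "trilinear_form sH sH sH (\<lambda>u v w. \<beta> (0, u) (0, v) (0, w))"
    unfolding trilinear_form_def
    by (intro conjI allI bilinear_form_components[OF 1] bilinear_form_components[OF 2])+
qed

text \<open>Dual to the product: for an element of \<open>A\<close>, and likewise for one of
  \<open>H\<close>, each of the eight blocks of the triple tensor product carries one hypothesis.
  Blocks interchanged by \<open>\<tau>\<^sub>1\<^sub>3\<close> share a condition.\<close>

lemma antiflexible_coalgebra_E:
  assumes "cycle_cross_coproduct_system"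
  shows "antiflexible_coalgebra scaleE \<Delta>E"
proof -
  note S = assms[unfolded cycle_cross_coproduct_system_def Q_antiflexible_coalgebra_def
      P_antiflexible_coalgebra_def cycle_A_def cycle_H_def Let_def tensor_eq3_iff
      pair3_add pair3_diff pair3_tau13 pair3_ext_left pair3_ext_right]
  note SA = S[THEN conjunct1] and SH = S[THEN conjunct2, THEN conjunct1]
  note T1 = S[THEN conjunct2, THEN conjunct2]
  note T2 = T1[THEN conjunct2] note T3 = T2[THEN conjunct2] note T4 = T3[THEN conjunct2]
  note T5 = T4[THEN conjunct2] note T6 = T5[THEN conjunct2] note T7 = T6[THEN conjunct2]
  note coassoc_A = SA[THEN conjunct2, rule_format] and cycle_Q = SA[THEN conjunct1, rule_format]
  note coassoc_H = SH[THEN conjunct2, rule_format] and cycle_P = SH[THEN conjunct1, rule_format]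
  note S1 = T1[THEN conjunct1, rule_format] and S2 = T2[THEN conjunct1, rule_format]
    and S3 = T3[THEN conjunct1, rule_format] and S4 = T4[THEN conjunct1, rule_format]
    and S5 = T5[THEN conjunct1, rule_format] and S6 = T6[THEN conjunct1, rule_format]
    and S7 = T7[THEN conjunct1, rule_format] and S8 = T7[THEN conjunct2, rule_format]
  have "pair2 (\<Delta>E p) (\<lambda>u v. pair2 (\<Delta>E u) (\<lambda>s t. \<beta> s t v))
      - pair2 (\<Delta>E p) (\<lambda>u v. pair2 (\<Delta>E v) (\<lambda>s t. \<beta> u s t))
    = pair2 (\<Delta>E p) (\<lambda>u v. pair2 (\<Delta>E u) (\<lambda>s t. \<beta> v t s))
      - pair2 (\<Delta>E p) (\<lambda>u v. pair2 (\<Delta>E v) (\<lambda>s t. \<beta> t s u))"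
    if \<beta>: "trilinear_form scaleE scaleE scaleE \<beta>" for p \<beta>
  proof -
    obtain a x where p: "p = (a, x)" by (metis surj_pair)
    note swapped = trilinear_form_swap[OF \<beta>]
    note c = trilinear_form_components[OF \<beta>] and d = trilinear_form_components[OF swapped]
    \<comment> \<open>Inner coproducts are taken at elements of one summand with one slot of the
      form frozen. The reversed form serves the side with
      \<open>\<tau>\<^sub>1\<^sub>3\<close>.\<close>
    note expand = pair2_\<Delta>E_A[OF trilinear_form_bilinear(1)[OF \<beta>]]
      pair2_\<Delta>E_A[OF trilinear_form_bilinear(2)[OF \<beta>]]
      pair2_\<Delta>E_H[OF trilinear_form_bilinear(1)[OF \<beta>]]
      pair2_\<Delta>E_H[OF trilinear_form_bilinear(2)[OF \<beta>]]
      pair2_\<Delta>E_A[OF trilinear_form_bilinear(1)[OF swapped]]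
      pair2_\<Delta>E_A[OF trilinear_form_bilinear(2)[OF swapped]]
      pair2_\<Delta>E_H[OF trilinear_form_bilinear(1)[OF swapped]]
      pair2_\<Delta>E_H[OF trilinear_form_bilinear(2)[OF swapped]]
    txt \<open>
      As for the product, with the form restricted to the components of the triple tensor product;
      \<open>d\<close> provides the components exchanged by \<open>\<tau>\<^sub>1\<^sub>3\<close>.
    \<close>
    note eqA = coassoc_A[OF c(1)] cycle_P[OF c(8)] S1[OF c(2)] S1[OF d(2), symmetric] S2[OF c(3)]
      S3[OF c(7)] S3[OF d(7), symmetric] S4[OF c(6), symmetric]
    note eqH = coassoc_H[OF c(8)] cycle_Q[OF c(1)] S5[OF c(5)] S5[OF d(5), symmetric] S6[OF c(6)]
      S7[OF c(4)] S7[OF d(4), symmetric] S8[OF c(3)]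
    show ?thesis
      by (rule eq_from_diff[OF _ add_eqs[OF
              sum_eqs8[OF eqA, of a a a a a a a a] sum_eqs8[OF eqH, of x x x x x x x x]]],
          simp only: p pair2_\<Delta>E[of a x] pairA_def pairH_def expand pair2_add_right,
          simp only: algebra_simps)
  qed
  then show ?thesis
    by (auto simp: antiflexible_coalgebra_def vector_space_E tensor_linear_\<Delta>E Let_def tensor_eq3_iff)
qed

section \<open>Reduction to homogeneous arguments and components\<close>

text \<open>\<open>D\<close> is a defect with its two arguments fixed, regarded as a function of the
  form. The test forms live on a single block and are pulled back along the projections.\<close>

definition vanishes_AA :: "(('b \<times> 'c \<Rightarrow> 'b \<times> 'c \<Rightarrow> 'a) \<Rightarrow> 'a) \<Rightarrow> bool" where
  "vanishes_AA D \<longleftrightarrow> (\<forall>\<beta>. bilinear_form sA sA \<beta> \<longrightarrow> D (\<lambda>p q. \<beta> (fst p) (fst q)) = 0)"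

definition vanishes_HA :: "(('b \<times> 'c \<Rightarrow> 'b \<times> 'c \<Rightarrow> 'a) \<Rightarrow> 'a) \<Rightarrow> bool" where
  "vanishes_HA D \<longleftrightarrow> (\<forall>\<beta>. bilinear_form sH sA \<beta> \<longrightarrow> D (\<lambda>p q. \<beta> (snd p) (fst q)) = 0)"

definition vanishes_AH :: "(('b \<times> 'c \<Rightarrow> 'b \<times> 'c \<Rightarrow> 'a) \<Rightarrow> 'a) \<Rightarrow> bool" where
  "vanishes_AH D \<longleftrightarrow> (\<forall>\<beta>. bilinear_form sA sH \<beta> \<longrightarrow> D (\<lambda>p q. \<beta> (fst p) (snd q)) = 0)"

definition vanishes_HH :: "(('b \<times> 'c \<Rightarrow> 'b \<times> 'c \<Rightarrow> 'a) \<Rightarrow> 'a) \<Rightarrow> bool" where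
  "vanishes_HH D \<longleftrightarrow> (\<forall>\<beta>. bilinear_form sH sH \<beta> \<longrightarrow> D (\<lambda>p q. \<beta> (snd p) (snd q)) = 0)"

lemmas vanishes_defs = vanishes_AA_def vanishes_HA_def vanishes_AH_def vanishes_HH_def

lemma vanishes_iff:
  assumes "\<And>\<beta> \<beta>'. D (\<lambda>u v. \<beta> u v + \<beta>' u v) = D \<beta> + D \<beta>'"
  shows "(\<forall>\<beta>. bilinear_form scaleE scaleE \<beta> \<longrightarrow> D \<beta> = 0) \<longleftrightarrow>
    vanishes_AA D \<and> vanishes_HA D \<and> vanishes_AH D \<and> vanishes_HH D"
proof
  assume "\<forall>\<beta>. bilinear_form scaleE scaleE \<beta> \<longrightarrow> D \<beta> = 0"
  then show "vanishes_AA D \<and> vanishes_HA D \<and> vanishes_AH D \<and> vanishes_HH D"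
    by (simp add: vanishes_defs bilinear_form_lifts)
next
  assume *: "vanishes_AA D \<and> vanishes_HA D \<and> vanishes_AH D \<and> vanishes_HH D"
  show "\<forall>\<beta>. bilinear_form scaleE scaleE \<beta> \<longrightarrow> D \<beta> = 0"
  proof safe
    fix \<beta> assume \<beta>: "bilinear_form scaleE scaleE \<beta>"
    note c = bilinear_form_components[OF \<beta>]
    have "D (\<lambda>p q. \<beta> (fst p, 0) (fst q, 0)) = 0" "D (\<lambda>p q. \<beta> (0, snd p) (fst q, 0)) = 0"
      "D (\<lambda>p q. \<beta> (fst p, 0) (0, snd q)) = 0" "D (\<lambda>p q. \<beta> (0, snd p) (0, snd q)) = 0"
      using * c(1) c(2) c(3) c(4) unfolding vanishes_defs by blast+
    then show "D \<beta> = 0"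
      by (subst bilinear_form_decompose[OF \<beta>]) (simp only: assms add_0_left)
  qed
qed

lemma vanishes_swap:
  "vanishes_AA (\<lambda>\<beta>. D (\<lambda>u v. \<beta> v u)) \<longleftrightarrow> vanishes_AA D"
  "vanishes_HA (\<lambda>\<beta>. D (\<lambda>u v. \<beta> v u)) \<longleftrightarrow> vanishes_AH D"
  "vanishes_AH (\<lambda>\<beta>. D (\<lambda>u v. \<beta> v u)) \<longleftrightarrow> vanishes_HA D"
  "vanishes_HH (\<lambda>\<beta>. D (\<lambda>u v. \<beta> v u)) \<longleftrightarrow> vanishes_HH D"
  unfolding vanishes_defs
  using all_bilinear_forms_swap[of sA sA "\<lambda>\<beta>. D (\<lambda>p q. \<beta> (fst p) (fst q)) = 0"]
    all_bilinear_forms_swap[of sH sA "\<lambda>\<beta>. D (\<lambda>p q. \<beta> (fst p) (snd q)) = 0"]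
    all_bilinear_forms_swap[of sA sH "\<lambda>\<beta>. D (\<lambda>p q. \<beta> (snd p) (fst q)) = 0"]
    all_bilinear_forms_swap[of sH sH "\<lambda>\<beta>. D (\<lambda>p q. \<beta> (snd p) (snd q)) = 0"]
  by simp_all

text \<open>Two homogeneous arguments and four blocks of forms give sixteen cases. Exchanging
  arguments while transposing the form removes the four with arguments in \<open>A\<close> and
  \<open>H\<close> in this order, and one of the two mixed blocks for each pair of arguments in the
  same summand; ten remain.\<close>

lemma defect_vanishes_iff:
  fixes D :: "'b \<times> 'c \<Rightarrow> 'b \<times> 'c \<Rightarrow> ('b \<times> 'c \<Rightarrow> 'b \<times> 'c \<Rightarrow> 'a) \<Rightarrow> 'a"
  assumes add_all: "\<forall>p p' q \<beta>. bilinear_form scaleE scaleE \<beta> \<longrightarrow> D (p + p') q \<beta> = D p q \<beta> + D p' q \<beta>"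
    and swap: "\<And>p q \<beta>. D q p \<beta> = D p q (\<lambda>u v. \<beta> v u)"
    and add_form: "\<And>p q \<beta> \<beta>'. D p q (\<lambda>u v. \<beta> u v + \<beta>' u v) = D p q \<beta> + D p q \<beta>'"
  shows "(\<forall>p q \<beta>. bilinear_form scaleE scaleE \<beta> \<longrightarrow> D p q \<beta> = 0) \<longleftrightarrow>
    (\<forall>a b. vanishes_AA (D (a, 0) (b, 0))) \<and> (\<forall>a b. vanishes_HA (D (a, 0) (b, 0))) \<and>
    (\<forall>a b. vanishes_HH (D (a, 0) (b, 0))) \<and>
    (\<forall>x y. vanishes_AA (D (0, x) (0, y))) \<and> (\<forall>x y. vanishes_AH (D (0, x) (0, y))) \<and>
    (\<forall>x y. vanishes_HH (D (0, x) (0, y))) \<and>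
    (\<forall>x b. vanishes_AA (D (0, x) (b, 0))) \<and> (\<forall>x b. vanishes_HA (D (0, x) (b, 0))) \<and>
    (\<forall>x b. vanishes_AH (D (0, x) (b, 0))) \<and> (\<forall>x b. vanishes_HH (D (0, x) (b, 0)))"
    (is "?L \<longleftrightarrow> ?R")
proof -
  note add = add_all[rule_format]
  have swap': "D q p = (\<lambda>\<beta>. D p q (\<lambda>u v. \<beta> v u))" for p q
    using swap by blast
  let ?Z = "\<lambda>p q. \<forall>\<beta>. bilinear_form scaleE scaleE \<beta> \<longrightarrow> D p q \<beta> = 0"
  have Z_swap: "?Z q p" if "?Z p q" for p q
    using that bilinear_form_swap by (subst swap') blast
  have "?L \<longleftrightarrow> (\<forall>a b. ?Z (a, 0) (b, 0)) \<and> (\<forall>x y. ?Z (0, x) (0, y)) \<and> (\<forall>x b. ?Z (0, x) (b, 0))"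
  proof safe
    fix a x b y \<beta>
    assume AA: "\<forall>a b. ?Z (a, 0) (b, 0)" and HH: "\<forall>x y. ?Z (0, x) (0, y)"
      and HA: "\<forall>x b. ?Z (0, x) (b, 0)" and \<beta>: "bilinear_form scaleE scaleE \<beta>"
    \<comment> \<open>This is additivity in the first argument for the transposed form.\<close>
    have add_right: "D p (q + q') \<beta> = D p q \<beta> + D p q' \<beta>" for p q q'
      by (subst (1 2 3) swap) (rule add[OF bilinear_form_swap[OF \<beta>]])
    have "D (a, x) (b, y) \<beta> = D ((a, 0) + (0, x)) ((b, 0) + (0, y)) \<beta>"
      by (simp only: add_Pair add_0_left add_0_right)
    also have "\<dots> = D (a, 0) (b, 0) \<beta> + D (0, x) (b, 0) \<beta> + (D (a, 0) (0, y) \<beta> + D (0, x) (0, y) \<beta>)"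
      by (simp only: add[OF \<beta>] add_right)
    also have "\<dots> = 0"
      using AA HH HA Z_swap[of "(0, y)" "(a, 0)"] \<beta> by simp
    finally show "D (a, x) (b, y) \<beta> = 0" .
  qed blast+
  also have "\<dots> \<longleftrightarrow> ?R"
  proof -
    \<comment> \<open>When both arguments range over the same summand, they can be exchanged under
      the quantifiers, so the two mixed blocks impose the same condition.\<close>
    have AH_swap: "vanishes_AH (D p q) \<longleftrightarrow> vanishes_HA (D q p)" for p q
      by (subst swap'[of q p]) (simp only: vanishes_swap)
    have "(\<forall>a b. vanishes_AH (D (a, 0) (b, 0))) \<longleftrightarrow> (\<forall>a b. vanishes_HA (D (a, 0) (b, 0)))"
      "(\<forall>x y. vanishes_AH (D (0, x) (0, y))) \<longleftrightarrow> (\<forall>x y. vanishes_HA (D (0, x) (0, y)))"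
      unfolding AH_swap by blast+
    then show ?thesis
      unfolding vanishes_iff[of "D _ _", OF add_form] all_conj_distrib by argo
  qed
  finally show ?thesis .
qed

section \<open>Matching the blocks of the defects with the given conditions\<close>

abbreviation "product_defect_E \<equiv> product_defect mE \<Delta>E"

abbreviation "skew_defect_E \<equiv> skew_defect mE \<Delta>E"

text \<open>At an argument in one summand, the coproduct of the other, zero, component vanishes only
  after pairing with a bilinear form. These rules supply that bilinearity for forms containing a
  product.\<close>

lemmas pair2_\<Delta>E_mult = bilinear_form_mult[OF bilinear_mE, THEN pair2_\<Delta>E_A]
  bilinear_form_mult[OF bilinear_mE, THEN pair2_\<Delta>E_H]

lemmas pair2_\<Delta>E_mult_AA = pair2_\<Delta>E_mult[OF bilinear_form_lifts(1)]
lemmas pair2_\<Delta>E_mult_HA = pair2_\<Delta>E_mult[OF bilinear_form_lifts(2)]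
lemmas pair2_\<Delta>E_mult_AH = pair2_\<Delta>E_mult[OF bilinear_form_lifts(3)]
lemmas pair2_\<Delta>E_mult_HH = pair2_\<Delta>E_mult[OF bilinear_form_lifts(4)]

lemmas expand = pair2_\<Delta>E pairA_def pairH_def mE_pair map_zero id_minus_tau_def

text \<open>Each condition lives on one block: the first eight belong to the product defect, the
  last seven to the skew defect, in the order of the definition.\<close>

lemma cocycle_double_matched_pair_iff:
  "cocycle_double_matched_pair \<longleftrightarrow>
    (\<forall>a b. vanishes_HA (product_defect_E (a, 0) (b, 0))) \<and>
    (\<forall>x y. vanishes_AH (product_defect_E (0, x) (0, y))) \<and>
    (\<forall>x b. vanishes_AA (product_defect_E (0, x) (b, 0))) \<and>
    (\<forall>a y. vanishes_HH (product_defect_E (a, 0) (0, y))) \<and>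
    (\<forall>a b. vanishes_HH (product_defect_E (a, 0) (b, 0))) \<and>
    (\<forall>x y. vanishes_AA (product_defect_E (0, x) (0, y))) \<and>
    (\<forall>x b. vanishes_HA (product_defect_E (0, x) (b, 0))) \<and>
    (\<forall>x b. vanishes_AH (product_defect_E (0, x) (b, 0))) \<and>
    (\<forall>a b. vanishes_AH (skew_defect_E (a, 0) (b, 0))) \<and>
    (\<forall>a b. vanishes_HH (skew_defect_E (a, 0) (b, 0))) \<and>
    (\<forall>x b. vanishes_HH (skew_defect_E (0, x) (b, 0))) \<and>
    (\<forall>x b. vanishes_AA (skew_defect_E (0, x) (b, 0))) \<and>
    (\<forall>x b. vanishes_HA (skew_defect_E (0, x) (b, 0))) \<and>
    (\<forall>x y. vanishes_HA (skew_defect_E (0, x) (0, y))) \<and>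
    (\<forall>x y. vanishes_AA (skew_defect_E (0, x) (0, y)))"
  unfolding cocycle_double_matched_pair_def tensor_eq_iff vanishes_defs
\<comment> \<open>After removing conjunctions, quantifiers and the bilinearity premise, each goal
  states that the difference of the two sides of a condition is the defect on its block.\<close>
proof (intro arg_cong2[where f="(\<and>)"] arg_cong[where f=All] ext imp_cong refl eq_iff_diff_zero, goal_cases)
  \<comment> \<open>Terms off the tested block have a zero in one slot of the form and drop out by
    bilinearity; the other cases work in the same way.\<close>
  case (1 a b \<beta>) then show ?case
    unfolding product_defect_def pair2_\<Delta>E_mult_HA[OF 1]
    by (simp add: expand bilinear_form_zero_left[OF 1] bilinear_form_zero_right[OF 1])
next
  case (2 x y \<beta>) then show ?case
    unfolding product_defect_def pair2_\<Delta>E_mult_AH[OF 2]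
    by (simp add: expand bilinear_form_zero_left[OF 2] bilinear_form_zero_right[OF 2])
next
  case (3 x b \<beta>) then show ?case
    unfolding product_defect_def pair2_\<Delta>E_mult_AA[OF 3]
    by (simp add: expand bilinear_form_zero_left[OF 3] bilinear_form_zero_right[OF 3])
next
  case (4 a y \<beta>) then show ?case
    unfolding product_defect_def pair2_\<Delta>E_mult_HH[OF 4]
    by (simp add: expand bilinear_form_zero_left[OF 4] bilinear_form_zero_right[OF 4])
next
  case (5 a b \<beta>) then show ?case
    unfolding product_defect_def pair2_\<Delta>E_mult_HH[OF 5]
    by (simp add: expand bilinear_form_zero_left[OF 5] bilinear_form_zero_right[OF 5])
next
  case (6 x y \<beta>) then show ?case
    unfolding product_defect_def pair2_\<Delta>E_mult_AA[OF 6]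
    by (simp add: expand bilinear_form_zero_left[OF 6] bilinear_form_zero_right[OF 6])
next
  case (7 x b \<beta>) then show ?case
    unfolding product_defect_def pair2_\<Delta>E_mult_HA[OF 7]
    by (simp add: expand bilinear_form_zero_left[OF 7] bilinear_form_zero_right[OF 7])
next
  case (8 x b \<beta>) then show ?case
    unfolding product_defect_def pair2_\<Delta>E_mult_AH[OF 8]
    by (simp add: expand bilinear_form_zero_left[OF 8] bilinear_form_zero_right[OF 8])
next
  case (9 a b \<beta>) then show ?case
    unfolding skew_defect_def pair2_\<Delta>E_mult_AH[OF 9]
    by (simp add: expand bilinear_form_zero_left[OF 9] bilinear_form_zero_right[OF 9])
next
  case (10 a b \<beta>) then show ?case
    unfolding skew_defect_def pair2_\<Delta>E_mult_HH[OF 10]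
    by (simp add: expand bilinear_form_zero_left[OF 10] bilinear_form_zero_right[OF 10])
next
  case (11 x b \<beta>) then show ?case
    unfolding skew_defect_def pair2_\<Delta>E_mult_HH[OF 11]
    by (simp add: expand bilinear_form_zero_left[OF 11] bilinear_form_zero_right[OF 11])
next
  case (12 x b \<beta>) then show ?case
    unfolding skew_defect_def pair2_\<Delta>E_mult_AA[OF 12]
    by (simp add: expand bilinear_form_zero_left[OF 12] bilinear_form_zero_right[OF 12])
next
  case (13 x b \<beta>) then show ?case
    unfolding skew_defect_def pair2_\<Delta>E_mult_HA[OF 13]
    by (simp add: expand bilinear_form_zero_left[OF 13] bilinear_form_zero_right[OF 13])
next
  case (14 x y \<beta>) then show ?case
    unfolding skew_defect_def pair2_\<Delta>E_mult_HA[OF 14]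
    by (simp add: expand bilinear_form_zero_left[OF 14] bilinear_form_zero_right[OF 14])
next
  case (15 x y \<beta>) then show ?case
    unfolding skew_defect_def pair2_\<Delta>E_mult_AA[OF 15]
    by (simp add: expand bilinear_form_zero_left[OF 15] bilinear_form_zero_right[OF 15])
qed

text \<open>The braided conditions are the blocks with arguments and form all on \<open>A\<close>.
  Their extra terms arise where a product or coproduct of \<open>A \<oplus> H\<close> passes through
  \<open>H\<close> and returns to \<open>A\<close>.\<close>

lemma cocycle_braided_A_vanishes:
  assumes "cocycle_braided_A"
  shows "vanishes_AA (product_defect_E (a, 0) (b, 0))" "vanishes_AA (skew_defect_E (a, 0) (b, 0))"
proof -
  note B = assms[unfolded cocycle_braided_A_def tensor_eq_iff, THEN conjunct2, THEN conjunct2]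
  show "vanishes_AA (product_defect_E (a, 0) (b, 0))"
    unfolding vanishes_defs
  proof safe
    fix \<beta> assume \<beta>: "bilinear_form sA sA \<beta>"
    show "product_defect_E (a, 0) (b, 0) (\<lambda>p q. \<beta> (fst p) (fst q)) = 0"
      unfolding product_defect_def pair2_\<Delta>E_mult_AA[OF \<beta>]
      by (rule eq_iff_diff_zero[THEN iffD1, OF _ B[THEN conjunct1, rule_format, OF \<beta>, of a b]])
        (simp add: expand bilinear_form_zero_left[OF \<beta>] bilinear_form_zero_right[OF \<beta>])
  qed
  show "vanishes_AA (skew_defect_E (a, 0) (b, 0))"
    unfolding vanishes_defs
  proof safe
    fix \<beta> assume \<beta>: "bilinear_form sA sA \<beta>"
    show "skew_defect_E (a, 0) (b, 0) (\<lambda>p q. \<beta> (fst p) (fst q)) = 0"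
      unfolding skew_defect_def pair2_\<Delta>E_mult_AA[OF \<beta>]
      by (rule eq_iff_diff_zero[THEN iffD1, OF _ B[THEN conjunct2, rule_format, OF \<beta>, of a b]])
        (simp add: expand bilinear_form_zero_left[OF \<beta>] bilinear_form_zero_right[OF \<beta>])
  qed
qed

lemma cocycle_braided_H_vanishes:
  assumes "cocycle_braided_H"
  shows "vanishes_HH (product_defect_E (0, x) (0, y))" "vanishes_HH (skew_defect_E (0, x) (0, y))"
proof -
  note B = assms[unfolded cocycle_braided_H_def tensor_eq_iff, THEN conjunct2, THEN conjunct2]
  show "vanishes_HH (product_defect_E (0, x) (0, y))"
    unfolding vanishes_defs
  proof safe
    fix \<beta> assume \<beta>: "bilinear_form sH sH \<beta>"
    show "product_defect_E (0, x) (0, y) (\<lambda>p q. \<beta> (snd p) (snd q)) = 0"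
      unfolding product_defect_def pair2_\<Delta>E_mult_HH[OF \<beta>]
      by (rule eq_iff_diff_zero[THEN iffD1, OF _ B[THEN conjunct1, rule_format, OF \<beta>, of x y]])
        (simp add: expand bilinear_form_zero_left[OF \<beta>] bilinear_form_zero_right[OF \<beta>])
  qed
  show "vanishes_HH (skew_defect_E (0, x) (0, y))"
    unfolding vanishes_defs
  proof safe
    fix \<beta> assume \<beta>: "bilinear_form sH sH \<beta>"
    show "skew_defect_E (0, x) (0, y) (\<lambda>p q. \<beta> (snd p) (snd q)) = 0"
      unfolding skew_defect_def pair2_\<Delta>E_mult_HH[OF \<beta>]
      by (rule eq_iff_diff_zero[THEN iffD1, OF _ B[THEN conjunct2, rule_format, OF \<beta>, of x y]])
        (simp add: expand bilinear_form_zero_left[OF \<beta>] bilinear_form_zero_right[OF \<beta>])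
  qed
qed

section \<open>The equivalence for \<open>A \<oplus> H\<close>\<close>

theorem antiflexible_bialgebra_E_iff:
  assumes A: "cocycle_braided_A" and H: "cocycle_braided_H"
    and "cocycle_cross_product_system" "cycle_cross_coproduct_system"
  shows "antiflexible_bialgebra scaleE mE \<Delta>E \<longleftrightarrow> cocycle_double_matched_pair"
proof -
  \<comment> \<open>Transposition preserves this block, so the arguments may be exchanged. This
    reconciles the condition stated for \<open>(a, y)\<close> with the reduction, which uses
    \<open>(x, b)\<close>.\<close>
  have product_HH: "vanishes_HH (product_defect_E p q) \<longleftrightarrow> vanishes_HH (product_defect_E q p)" for p q
  proof -
    have "product_defect_E q p = (\<lambda>\<beta>. product_defect_E p q (\<lambda>u v. \<beta> v u))"
      by (intro ext product_defect_swap)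
    then show ?thesis by (simp only: vanishes_swap)
  qed
  have product: "(\<forall>a y. vanishes_HH (product_defect_E (a, 0) (0, y)))
      \<longleftrightarrow> (\<forall>x b. vanishes_HH (product_defect_E (0, x) (b, 0)))"
    using product_HH by blast
  \<comment> \<open>Transposition exchanges the mixed blocks and only changes the sign of the skew
    defect, so both vanish together.\<close>
  have skew_HA: "vanishes_AH (skew_defect_E p q) \<longleftrightarrow> vanishes_HA (skew_defect_E p q)" for p q
  proof -
    have "(\<lambda>\<beta>. skew_defect_E p q (\<lambda>u v. \<beta> v u)) = (\<lambda>\<beta>. - skew_defect_E p q \<beta>)"
      by (intro ext skew_defect_swap_form)
    then have "vanishes_HA (skew_defect_E p q) \<longleftrightarrow> vanishes_AH (\<lambda>\<beta>. - skew_defect_E p q \<beta>)"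
      using vanishes_swap(3)[of "skew_defect_E p q"] by (simp only:)
    also have "\<dots> \<longleftrightarrow> vanishes_AH (skew_defect_E p q)"
      by (simp only: vanishes_AH_def neg_equal_0_iff_equal)
    finally show ?thesis by (rule sym)
  qed
  have skew_ab: "(\<forall>a b. vanishes_AH (skew_defect_E (a, 0) (b, 0)))
      \<longleftrightarrow> (\<forall>a b. vanishes_HA (skew_defect_E (a, 0) (b, 0)))"
    and skew_xy: "(\<forall>x y. vanishes_AH (skew_defect_E (0, x) (0, y)))
      \<longleftrightarrow> (\<forall>x y. vanishes_HA (skew_defect_E (0, x) (0, y)))"
    and skew_xb: "(\<forall>x b. vanishes_AH (skew_defect_E (0, x) (b, 0)))
      \<longleftrightarrow> (\<forall>x b. vanishes_HA (skew_defect_E (0, x) (b, 0)))"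
    by (simp_all add: skew_HA)
  have "\<forall>p p' q \<beta>. bilinear_form scaleE scaleE \<beta> \<longrightarrow>
      product_defect_E (p + p') q \<beta> = product_defect_E p q \<beta> + product_defect_E p' q \<beta>"
    by (simp add: product_defect_add_left[OF bilinear_mE tensor_linear_\<Delta>E])
  note product_iff = defect_vanishes_iff[OF this product_defect_swap product_defect_add_form]
  have "\<forall>p p' q \<beta>. bilinear_form scaleE scaleE \<beta> \<longrightarrow>
      skew_defect_E (p + p') q \<beta> = skew_defect_E p q \<beta> + skew_defect_E p' q \<beta>"
    by (simp add: skew_defect_add_left[OF bilinear_mE tensor_linear_\<Delta>E])
  note skew_iff = defect_vanishes_iff[OF this skew_defect_swap skew_defect_add_form]
  have "antiflexible_bialgebra scaleE mE \<Delta>E \<longleftrightarrow>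
      (\<forall>p q \<beta>. bilinear_form scaleE scaleE \<beta> \<longrightarrow> product_defect_E p q \<beta> = 0) \<and>
      (\<forall>p q \<beta>. bilinear_form scaleE scaleE \<beta> \<longrightarrow> skew_defect_E p q \<beta> = 0)"
    by (simp add: antiflexible_bialgebra_iff antiflexible_algebra_E antiflexible_coalgebra_E assms)
  also have "\<dots> \<longleftrightarrow> cocycle_double_matched_pair"
    \<comment> \<open>Of the ten blocks for each defect, four vanish by the braided hypotheses, and
      the two mixed skew blocks at \<open>(x, b)\<close> coincide. The remaining fifteen are the
      matched pair conditions.\<close>
    unfolding product_iff skew_iff cocycle_double_matched_pair_iff product skew_ab skew_xy skew_xb
    by (simp only: cocycle_braided_A_vanishes[OF A] cocycle_braided_H_vanishes[OF H] simp_thms) argo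
  finally show ?thesis .
qed

end

theorem theorem4p16:
  fixes sA :: "'k::field_char_0 \<Rightarrow> 'a::ab_group_add \<Rightarrow> 'a"
    and sH :: "'k \<Rightarrow> 'h::ab_group_add \<Rightarrow> 'h"
    and mA :: "'a \<Rightarrow> 'a \<Rightarrow> 'a"
    and mH :: "'h \<Rightarrow> 'h \<Rightarrow> 'h"
    and \<Delta>A :: "'a \<Rightarrow> ('a \<times> 'a \<Rightarrow>\<^sub>0 'k)"
    and \<Delta>H :: "'h \<Rightarrow> ('h \<times> 'h \<Rightarrow>\<^sub>0 'k)"
    and lA :: "'h \<Rightarrow> 'a \<Rightarrow> 'a"
    and rA :: "'a \<Rightarrow> 'h \<Rightarrow> 'a"
    and lH :: "'a \<Rightarrow> 'h \<Rightarrow> 'h"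
    and rH :: "'h \<Rightarrow> 'a \<Rightarrow> 'h"
    and \<phi> :: "'a \<Rightarrow> ('h \<times> 'a \<Rightarrow>\<^sub>0 'k)"
    and \<psi> :: "'a \<Rightarrow> ('a \<times> 'h \<Rightarrow>\<^sub>0 'k)"
    and \<rho> :: "'h \<Rightarrow> ('a \<times> 'h \<Rightarrow>\<^sub>0 'k)"
    and \<gamma> :: "'h \<Rightarrow> ('h \<times> 'a \<Rightarrow>\<^sub>0 'k)"
    and \<sigma> :: "'h \<Rightarrow> 'h \<Rightarrow> 'a"
    and \<theta> :: "'a \<Rightarrow> 'a \<Rightarrow> 'h"
    and P :: "'a \<Rightarrow> ('h \<times> 'h \<Rightarrow>\<^sub>0 'k)"
    and Q :: "'h \<Rightarrow> ('a \<times> 'a \<Rightarrow>\<^sub>0 'k)"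
  assumes "vector_space sA" and "vector_space sH"
    and "bilinear_map sA sA sA mA" and "bilinear_map sH sH sH mH"
    and "tensor_linear sA sA sA \<Delta>A" and "tensor_linear sH sH sH \<Delta>H"
    and "bilinear_map sH sA sA lA" and "bilinear_map sA sH sA rA"
    and "bilinear_map sA sH sH lH" and "bilinear_map sH sA sH rH"
    and "tensor_linear sA sH sA \<phi>" and "tensor_linear sA sA sH \<psi>"
    and "tensor_linear sH sA sH \<rho>" and "tensor_linear sH sH sA \<gamma>"
    and "bilinear_map sH sH sA \<sigma>" and "bilinear_map sA sA sH \<theta>"
    and "tensor_linear sA sH sH P" and "tensor_linear sH sA sA Q"
    and "antiflexible_pair.cocycle_braided_A sA mA \<Delta>A lA rA lH rH \<phi> \<psi> \<rho> \<gamma> \<theta> Q"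
    and "antiflexible_pair.cocycle_braided_H sH mH \<Delta>H lA rA lH rH \<phi> \<psi> \<rho> \<gamma> \<sigma> P"
    and "antiflexible_pair.cocycle_cross_product_system mA mH lA rA lH rH \<sigma> \<theta>"
    and "antiflexible_pair.cycle_cross_coproduct_system sA sH \<Delta>A \<Delta>H \<phi> \<psi> \<rho> \<gamma> P Q"
  shows "antiflexible_bialgebra
           (antiflexible_pair.scaleE sA sH)
           (antiflexible_pair.mE mA mH lA rA lH rH \<sigma> \<theta>)
           (antiflexible_pair.\<Delta>E \<Delta>A \<Delta>H \<phi> \<psi> \<rho> \<gamma> P Q)
     \<longleftrightarrow> antiflexible_pair.cocycle_double_matched_pair
           sA sH mA mH \<Delta>A \<Delta>H lA rA lH rH \<phi> \<psi> \<rho> \<gamma> \<sigma> \<theta> P Q"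
proof -
  interpret linear_antiflexible_pair sA sH mA mH \<Delta>A \<Delta>H lA rA lH rH \<phi> \<psi> \<rho> \<gamma> \<sigma> \<theta> P Q
    by (intro linear_antiflexible_pair.intro assms(1-18))
  show ?thesis
    using assms(19-22) by (rule antiflexible_bialgebra_E_iff)
qed

end
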